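(* Let $a\in\mathbb Z$, let $P\colon\mathcal W_{1,\epsilon}\to\mathcal W_{1,\epsilon}$ be an odd linear map with $P^2=1$, and let $L(a)$ be the length-$1$ segment module over $RC_{\alpha_a}$. Then there are isomorphisms of super vector spaces \[V'^{\otimes\alpha_a}_{\mathbb O}\otimes_{RC_{\alpha_a}}L(a)\simeq\mathcal W_{1,\epsilon},\qquad V^{\mathsf{tw}\otimes\alpha_a}_{\mathbb O}\otimes_{RC_{\alpha_a}}L(a)\simeq\mathcal W_{1,\epsilon}.\]
   Context: $\Bbbk=\overline{\mathbb Q(q)}$; $\mathrm{par}$ is $\mathbb Z/2\mathbb Z$-parity. $\mathcal W_{1,\epsilon}$ (the vector representation of the generalized quantum group $\mathcal U(\epsilon)$ with $\epsilon=(0^M,1^M)$, $M\ge2$) is, as a superspace, $\Bbbk^{M|M}$. $RC_{\alpha_a}$ (type $A_\infty$ quiver Hecke--Clifford superalgebra of height one) is the superalgebra generated by even $e(a,0),e(a,1),x$ and odd $\mathsf c$ with relations: $e(a,0),e(a,1)$ are orthogonal idempotents with sum $1$, $xe(a,\varepsilon)=e(a,\varepsilon)x$, $\mathsf ce(a,\varepsilon)=e(a,1-\varepsilon)\mathsf c$, $\mathsf c^2=1$, $\mathsf cx=-x\mathsf c$. $L(a)$ is the left $RC_{\alpha_a}$-supermodule with basis $u_0$ (even), $u_1$ (odd), where $u_j=\mathsf c^je(a,0)$: $xu_j=0$, $\mathsf cu_0=u_1$, $\mathsf cu_1=u_0$, $e(a,\varepsilon)u_j=\delta_{\varepsilon,j}u_j$.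 For $\sharp\in\{\,',\mathsf{tw}\}$ put $X'(a,\varepsilon)=q^{-2a}$, $X^{\mathsf{tw}}(a,\varepsilon)=q^{-(-1)^\varepsilon2a}$, and \[V^{\sharp\otimes\alpha_a}_{\mathbb O}=\bigoplus_{\varepsilon\in\{0,1\}}\big(\Bbbk[[z-X^\sharp(a,\varepsilon)]]\otimes_\Bbbk\mathcal W_{1,\epsilon}\big)e(a,\varepsilon),\] with power series even. The right $RC_{\alpha_a}$-action is: $e(a,\varepsilon)$ is the projection on the $\varepsilon$-summand; $(f\otimes v)e(a,\varepsilon).x=(-1)^\varepsilon x_\varepsilon f\otimes v\,e(a,\varepsilon)$, where $x_\varepsilon=\frac{z-X'(a,\varepsilon)}{X'(a,\varepsilon)}$ for $\sharp={}'$ and $x_\varepsilon=\frac{z-X^{\mathsf{tw}}(a,\varepsilon)}{z+X^{\mathsf{tw}}(a,\varepsilon)}$ for $\sharp=\mathsf{tw}$; and $(f\otimes v)e(a,\varepsilon).\mathsf c=(-1)^{\mathrm{par}(v)}\sqrt{-1}\,\theta^\sharp(f)\otimes P(v)\,e(a,1-\varepsilon)$, where $\theta'(f)=f$ and $\theta^{\mathsf{tw}}(f)(z)=f(z^{-1})$.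
   Formalization: In the twisted case the printed factor (-1)^ε in the action of x makes x and c commute, contradicting cx=-xc; the isomorphism is proved with this factor dropped, and also with it kept for the tensor product over the free algebra on the generators. *)

theory Defs
  imports
    "HOL-Analysis.Finite_Cartesian_Product"
    "HOL-Algebra.Algebraic_Closure_Type"
    "HOL-Computational_Algebra.Fraction_Field"
    "HOL-Computational_Algebra.Formal_Power_Series"
    "HOL-Library.Poly_Mapping"
    "HOL-Library.Function_Algebras"
    "HOL-Library.Set_Algebras"
    "HOL-Library.Z2"
begin

section \<open>The ground field\<close>

type_synonym kk = "rat poly fract alg_closure"

definition qq :: kk where
  "qq = to_ac (Fract [:0, 1:] 1)"

definition sqrt_m1 :: kk where
  "sqrt_m1 = (SOME i. i * i = -1)"

lemma sqrt_m1: "sqrt_m1 * sqrt_m1 = -1"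
proof -
  obtain y :: kk where "y ^ 2 = -1"
    using nth_root_exists[of 2 "-1 :: kk"] by auto
  then show ?thesis
    unfolding sqrt_m1_def by (metis (mono_tags, lifting) power2_eq_square someI_ex)
qed

lemma qq_nonzero [simp]: "qq \<noteq> 0"
  by (simp add: qq_def Fract_conv_to_fract)

text \<open>The type \<^typ>\<open>bit\<close> of integers mod 2 is used both for parities and for the label
  \<open>\<epsilon>\<close> of the idempotents \<open>e(a, \<epsilon>)\<close>; thus \<open>1 - \<epsilon>\<close> is \<open>\<epsilon> + 1\<close>, and \<open>(-1)\<^sup>\<epsilon>\<close> is \<open>sgn2 \<epsilon>\<close>.\<close>

definition sgn2 :: "bit \<Rightarrow> 'a::ring_1" where
  "sgn2 \<epsilon> = (if \<epsilon> = 0 then 1 else -1)"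


section \<open>Vector spaces and superspaces over the ground field\<close>

class kk_space = ab_group_add +
  fixes smul :: "kk \<Rightarrow> 'a \<Rightarrow> 'a" (infixr "\<bullet>\<^sub>k" 75)
  assumes smul_add_right: "c \<bullet>\<^sub>k (v + w) = c \<bullet>\<^sub>k v + c \<bullet>\<^sub>k w"
    and smul_add_left: "(c + d) \<bullet>\<^sub>k v = c \<bullet>\<^sub>k v + d \<bullet>\<^sub>k v"
    and smul_smul: "c \<bullet>\<^sub>k (d \<bullet>\<^sub>k v) = (c * d) \<bullet>\<^sub>k v"
    and smul_one: "1 \<bullet>\<^sub>k v = v"

global_interpretation kk: vector_space "smul :: kk \<Rightarrow> 'a \<Rightarrow> 'a::kk_space"
  by standard (rule smul_add_right smul_add_left smul_smul smul_one)+

abbreviation kk_linear :: "('a::kk_space \<Rightarrow> 'b::kk_space) \<Rightarrow> bool" where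
  "kk_linear \<equiv> Vector_Spaces.linear smul smul"

lemma kk_linearI:
  "(\<And>v w. f (v + w) = f v + f w) \<Longrightarrow> (\<And>c v. f (c \<bullet>\<^sub>k v) = c \<bullet>\<^sub>k f v) \<Longrightarrow> kk_linear f"
  by (intro Vector_Spaces.linear.intro module_hom.intro module_hom_axioms.intro
      kk.vector_space_axioms kk.module_axioms) 

lemma kk_linear_add: "kk_linear f \<Longrightarrow> f (v + w) = f v + f w"
  and kk_linear_smul: "kk_linear f \<Longrightarrow> f (c \<bullet>\<^sub>k v) = c \<bullet>\<^sub>k f v"
  by (simp_all add: Vector_Spaces.linear_def module_hom_def module_hom_axioms_def)

lemma kk_linear_zero: "kk_linear f \<Longrightarrow> f 0 = 0"
  using kk_linear_smul[of f 0 0] by simp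

lemma kk_linear_minus: "kk_linear f \<Longrightarrow> f (- v) = - f v"
  using kk_linear_add[of f v "- v"] kk_linear_zero[of f] by (simp add: eq_neg_iff_add_eq_0 add.commute)

lemma kk_linear_diff: "kk_linear f \<Longrightarrow> f (v - w) = f v - f w"
  using kk_linear_add[of f v "- w"] kk_linear_minus[of f w] by simp

lemma kk_linear_sum: "kk_linear f \<Longrightarrow> f (\<Sum>i\<in>A. g i) = (\<Sum>i\<in>A. f (g i))"
  by (induction A rule: infinite_finite_induct) (simp_all add: kk_linear_zero kk_linear_add)

text \<open>\<open>part p\<close> is the subspace of elements that are homogeneous of parity \<open>p\<close>, including 0.\<close>

class superspace = kk_space +
  fixes part :: "bit \<Rightarrow> 'a set"
  assumes part_zero: "0 \<in> part p"
    and part_add: "v \<in> part p \<Longrightarrow> w \<in> part p \<Longrightarrow> v + w \<in> part p"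
    and part_smul: "v \<in> part p \<Longrightarrow> c \<bullet>\<^sub>k v \<in> part p"
    and part_direct_sum: "\<exists>!w. w \<in> part 0 \<and> v - w \<in> part 1"

definition even_comp :: "'a::superspace \<Rightarrow> 'a" where
  "even_comp v = (THE w. w \<in> part 0 \<and> v - w \<in> part 1)"

definition odd_comp :: "'a::superspace \<Rightarrow> 'a" where
  "odd_comp v = v - even_comp v"

text \<open>The linear map given by \<open>v \<mapsto> (-1)\<^bsup>par v\<^esup> v\<close> on homogeneous elements.\<close>

definition parity_inv :: "'a::superspace \<Rightarrow> 'a" where
  "parity_inv v = even_comp v - odd_comp v"

lemma even_comp_in: "even_comp v \<in> part 0" and odd_comp_in: "odd_comp v \<in> part 1"
  using theI'[OF part_direct_sum[of v]] by (auto simp: even_comp_def odd_comp_def)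

lemma even_odd_comp: "even_comp v + odd_comp v = v"
  by (simp add: odd_comp_def)

lemma even_comp_unique: "w \<in> part 0 \<Longrightarrow> v - w \<in> part 1 \<Longrightarrow> even_comp v = w"
  unfolding even_comp_def by (rule the1_equality[OF part_direct_sum]) auto

lemma linear_even_comp: "kk_linear even_comp"
proof (rule kk_linearI)
  fix v w :: 'a and c
  show "even_comp (v + w) = even_comp v + even_comp w"
  proof (rule even_comp_unique)
    have "(v + w) - (even_comp v + even_comp w) = odd_comp v + odd_comp w"
      by (simp add: odd_comp_def)
    then show "(v + w) - (even_comp v + even_comp w) \<in> part 1"
      by (simp add: part_add odd_comp_in)
  qed (simp add: part_add even_comp_in)
  show "even_comp (c \<bullet>\<^sub>k v) = c \<bullet>\<^sub>k even_comp v"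
  proof (rule even_comp_unique)
    have "c \<bullet>\<^sub>k v - c \<bullet>\<^sub>k even_comp v = c \<bullet>\<^sub>k odd_comp v"
      by (simp add: odd_comp_def kk.scale_right_diff_distrib)
    then show "c \<bullet>\<^sub>k v - c \<bullet>\<^sub>k even_comp v \<in> part 1"
      by (simp add: part_smul odd_comp_in)
  qed (simp add: part_smul even_comp_in)
qed

lemma linear_odd_comp: "kk_linear odd_comp"
  by (rule kk_linearI)
    (simp_all add: odd_comp_def kk_linear_add[OF linear_even_comp]
      kk_linear_smul[OF linear_even_comp] kk.scale_right_diff_distrib)

lemma linear_parity_inv: "kk_linear parity_inv"
  by (rule kk_linearI)
    (simp_all add: parity_inv_def kk_linear_add[OF linear_even_comp] kk_linear_add[OF linear_odd_comp]
      kk_linear_smul[OF linear_even_comp] kk_linear_smul[OF linear_odd_comp]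
      kk.scale_right_diff_distrib)

lemma even_comp_part: "v \<in> part p \<Longrightarrow> even_comp v = (if p = 0 then v else 0)"
  by (cases p) (auto intro!: even_comp_unique simp: part_zero)

lemma odd_comp_part: "v \<in> part p \<Longrightarrow> odd_comp v = (if p = 0 then 0 else v)"
  by (simp add: odd_comp_def even_comp_part)

lemma parity_inv_part: "v \<in> part p \<Longrightarrow> parity_inv v = sgn2 p \<bullet>\<^sub>k v"
  by (simp add: parity_inv_def even_comp_part odd_comp_part sgn2_def)

definition odd_map :: "('a::superspace \<Rightarrow> 'b::superspace) \<Rightarrow> bool" where
  "odd_map f \<longleftrightarrow> (\<forall>p. \<forall>v\<in>part p. f v \<in> part (p + 1))"

instantiation "fun" :: (type, kk_space) kk_space
begin
definition smul_fun :: "kk \<Rightarrow> ('a \<Rightarrow> 'b) \<Rightarrow> 'a \<Rightarrow> 'b" where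
  "c \<bullet>\<^sub>k f = (\<lambda>i. c \<bullet>\<^sub>k f i)"
instance
  by standard (simp_all add: smul_fun_def fun_eq_iff smul_add_right smul_add_left smul_smul smul_one)
end

text \<open>For a finite index type, functions are the direct sum of copies of the target.\<close>

instantiation "fun" :: (type, superspace) superspace
begin
definition part_fun :: "bit \<Rightarrow> ('a \<Rightarrow> 'b) set" where
  "part p = {f. \<forall>i. f i \<in> part p}"
instance
proof
  fix v :: "'a \<Rightarrow> 'b"
  show "\<exists>!w. w \<in> part 0 \<and> v - w \<in> part 1"
  proof (rule ex1I[of _ "\<lambda>i. even_comp (v i)"])
    show "(\<lambda>i. even_comp (v i)) \<in> part 0 \<and> v - (\<lambda>i. even_comp (v i)) \<in> part 1"
      using odd_comp_in by (auto simp: part_fun_def even_comp_in odd_comp_def)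
  next
    fix w assume "w \<in> part 0 \<and> v - w \<in> part 1"
    then show "w = (\<lambda>i. even_comp (v i))"
      by (auto simp: part_fun_def fun_eq_iff intro!: even_comp_unique[symmetric])
  qed
qed (simp_all add: part_fun_def smul_fun_def part_zero part_add part_smul)
end

lemma smul_fun_apply [simp]: "(c \<bullet>\<^sub>k f) i = c \<bullet>\<^sub>k f i"
  by (simp add: smul_fun_def)


section \<open>Tensor products over the ground field\<close>

definition free_lin :: "('x \<Rightarrow> 'v::kk_space) \<Rightarrow> ('x \<Rightarrow>\<^sub>0 kk) \<Rightarrow> 'v" where
  "free_lin h f = (\<Sum>x\<in>Poly_Mapping.keys f. Poly_Mapping.lookup f x \<bullet>\<^sub>k h x)"

definition free_smul :: "kk \<Rightarrow> ('x \<Rightarrow>\<^sub>0 kk) \<Rightarrow> ('x \<Rightarrow>\<^sub>0 kk)" where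
  "free_smul c = Poly_Mapping.map ((*) c)"

lemma lookup_free_smul [simp]:
  "Poly_Mapping.lookup (free_smul c f) x = c * Poly_Mapping.lookup f x"
  by (simp add: free_smul_def Poly_Mapping.map.rep_eq when_def)

lemma free_smul_single [simp]:
  "free_smul c (Poly_Mapping.single x d) = Poly_Mapping.single x (c * d)"
  by (rule poly_mapping_eqI) (simp add: lookup_single when_def)

lemma free_lin_superset:
  assumes "finite A" "Poly_Mapping.keys f \<subseteq> A"
  shows "free_lin h f = (\<Sum>x\<in>A. Poly_Mapping.lookup f x \<bullet>\<^sub>k h x)"
  unfolding free_lin_def
  by (rule sum.mono_neutral_left) (use assms in \<open>auto simp: in_keys_iff\<close>)

lemma free_lin_add: "free_lin h (f + g) = free_lin h f + free_lin h g"
proof -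
  let ?A = "Poly_Mapping.keys f \<union> Poly_Mapping.keys g"
  have k: "Poly_Mapping.keys (f + g) \<subseteq> ?A" by (rule Poly_Mapping.keys_add)
  show ?thesis
    by (simp add: free_lin_superset[OF _ k] free_lin_superset[of ?A f]
        free_lin_superset[of ?A g] lookup_add smul_add_left sum.distrib)
qed

lemma free_lin_smul: "free_lin h (free_smul c f) = c \<bullet>\<^sub>k free_lin h f"
proof -
  have k: "Poly_Mapping.keys (free_smul c f) \<subseteq> Poly_Mapping.keys f"
    by (auto simp: in_keys_iff)
  show ?thesis
    by (simp add: free_lin_superset[OF finite_keys k] free_lin_def[of h f] kk.scale_sum_right)
qed

lemma free_lin_single [simp]: "free_lin h (Poly_Mapping.single x c) = c \<bullet>\<^sub>k h x"
  by (cases "c = 0") (simp_all add: free_lin_def)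

lemma free_lin_zero [simp]: "free_lin h 0 = 0"
  by (simp add: free_lin_def)

lemma free_lin_uminus: "free_lin h (- f) = - free_lin h f"
  using free_lin_add[of h f "- f"] by (simp add: eq_neg_iff_add_eq_0 add.commute)

lemma free_lin_diff: "free_lin h (f - g) = free_lin h f - free_lin h g"
  using free_lin_add[of h f "- g"] by (simp add: free_lin_uminus)

lemma poly_mapping_sum_singles:
  "f = (\<Sum>x\<in>Poly_Mapping.keys f. Poly_Mapping.single x (Poly_Mapping.lookup f x))"
  by (rule poly_mapping_eqI)
    (simp add: lookup_sum lookup_single when_def in_keys_iff)

lemma poly_mapping_free_induct [case_names zero single add]:
  fixes f :: "'x \<Rightarrow>\<^sub>0 kk"
  assumes "P 0" "\<And>x c. P (Poly_Mapping.single x c)" "\<And>f g. P f \<Longrightarrow> P g \<Longrightarrow> P (f + g)"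
  shows "P f"
proof -
  have "P (\<Sum>x\<in>A. Poly_Mapping.single x (Poly_Mapping.lookup f x))" for A
    by (induction A rule: infinite_finite_induct) (use assms in auto)
  then show ?thesis by (subst poly_mapping_sum_singles)
qed

text \<open>The bilinearity relations: the subspace by which the free vector space on \<open>'a \<times> 'b\<close>
  is divided.  The coefficient \<open>k\<close> in the generators makes the set closed under scalars.\<close>

inductive_set tensor_null :: "('a::kk_space \<times> 'b::kk_space \<Rightarrow>\<^sub>0 kk) set" where
  zero: "0 \<in> tensor_null"
| add: "f \<in> tensor_null \<Longrightarrow> g \<in> tensor_null \<Longrightarrow> f + g \<in> tensor_null"
| add_left: "Poly_Mapping.single (v + v', w) k - Poly_Mapping.single (v, w) k
    - Poly_Mapping.single (v', w) k \<in> tensor_null"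
| add_right: "Poly_Mapping.single (v, w + w') k - Poly_Mapping.single (v, w) k
    - Poly_Mapping.single (v, w') k \<in> tensor_null"
| smul_left: "Poly_Mapping.single (c \<bullet>\<^sub>k v, w) k - Poly_Mapping.single (v, w) (k * c) \<in> tensor_null"
| smul_right: "Poly_Mapping.single (v, c \<bullet>\<^sub>k w) k - Poly_Mapping.single (v, w) (k * c) \<in> tensor_null"

lemma free_smul_add: "free_smul c (f + g) = free_smul c f + free_smul c g"
  by (rule poly_mapping_eqI) (simp add: lookup_add algebra_simps)

lemma free_smul_diff: "free_smul c (f - g) = free_smul c f - free_smul c g"
  by (rule poly_mapping_eqI) (simp add: lookup_minus algebra_simps)

lemma tensor_null_smul: "f \<in> tensor_null \<Longrightarrow> free_smul c f \<in> tensor_null"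
proof (induction rule: tensor_null.induct)
  case zero
  have "free_smul c 0 = (0 :: 'a \<times> 'b \<Rightarrow>\<^sub>0 kk)" by (rule poly_mapping_eqI) simp
  then show ?case by (simp add: tensor_null.zero)
next
  case (add f g)
  then show ?case unfolding free_smul_add by (intro tensor_null.add)
next
  case (add_left v v' w k)
  show ?case unfolding free_smul_diff free_smul_single by (rule tensor_null.add_left)
next
  case (add_right v w w' k)
  show ?case unfolding free_smul_diff free_smul_single by (rule tensor_null.add_right)
next
  case (smul_left d v w k)
  show ?case unfolding free_smul_diff free_smul_single mult.assoc[symmetric]
    by (rule tensor_null.smul_left)
next
  case (smul_right v d w k)
  show ?case unfolding free_smul_diff free_smul_single mult.assoc[symmetric]
    by (rule tensor_null.smul_right)
qed

lemma tensor_null_uminus: "f \<in> tensor_null \<Longrightarrow> - f \<in> tensor_null"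
proof -
  have "- f = free_smul (-1) f" by (rule poly_mapping_eqI) simp
  then show "f \<in> tensor_null \<Longrightarrow> - f \<in> tensor_null" by (simp add: tensor_null_smul)
qed

lemma tensor_null_diff: "f \<in> tensor_null \<Longrightarrow> g \<in> tensor_null \<Longrightarrow> f - g \<in> tensor_null"
  using tensor_null.add[of f "- g"] tensor_null_uminus[of g] by simp

lemma diff_diff_swap: "(a - a') - (b - b') = (a - b) - (a' - (b' :: 'a::ab_group_add))"
  by (simp add: algebra_simps)

quotient_type (overloaded) ('a, 'b) tensor =
  "('a::kk_space \<times> 'b::kk_space) \<Rightarrow>\<^sub>0 kk" / "\<lambda>f g. f - g \<in> tensor_null"
proof (rule equivpI)
  show "reflp (\<lambda>f g :: 'a \<times> 'b \<Rightarrow>\<^sub>0 kk. f - g \<in> tensor_null)"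
    by (rule reflpI) (simp add: tensor_null.zero)
  show "symp (\<lambda>f g :: 'a \<times> 'b \<Rightarrow>\<^sub>0 kk. f - g \<in> tensor_null)"
    proof (rule sympI)
    fix f g :: "'a \<times> 'b \<Rightarrow>\<^sub>0 kk"
    assume "f - g \<in> tensor_null"
    from tensor_null_uminus[OF this] show "g - f \<in> tensor_null" by simp
  qed
  show "transp (\<lambda>f g :: 'a \<times> 'b \<Rightarrow>\<^sub>0 kk. f - g \<in> tensor_null)"
    proof (rule transpI)
    fix f g h :: "'a \<times> 'b \<Rightarrow>\<^sub>0 kk"
    assume "f - g \<in> tensor_null" "g - h \<in> tensor_null"
    from tensor_null.add[OF this] show "f - h \<in> tensor_null" by simp
  qed
qed

instantiation tensor :: (kk_space, kk_space) kk_space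
begin

lift_definition zero_tensor :: "('a, 'b) tensor" is 0 .

lift_definition plus_tensor :: "('a, 'b) tensor \<Rightarrow> ('a, 'b) tensor \<Rightarrow> ('a, 'b) tensor" is "(+)"
  unfolding add_diff_add by (rule tensor_null.add)

lift_definition uminus_tensor :: "('a, 'b) tensor \<Rightarrow> ('a, 'b) tensor" is uminus
  unfolding minus_diff_minus by (rule tensor_null_uminus)

lift_definition minus_tensor :: "('a, 'b) tensor \<Rightarrow> ('a, 'b) tensor \<Rightarrow> ('a, 'b) tensor" is "(-)"
proof -
  fix f f' g g' :: "'a \<times> 'b \<Rightarrow>\<^sub>0 kk"
  assume "f - f' \<in> tensor_null" "g - g' \<in> tensor_null"
  then have "(f - f') - (g - g') \<in> tensor_null" by (rule tensor_null_diff)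
  then show "(f - g) - (f' - g') \<in> tensor_null" unfolding diff_diff_swap .
qed

lift_definition smul_tensor :: "kk \<Rightarrow> ('a, 'b) tensor \<Rightarrow> ('a, 'b) tensor" is free_smul
  unfolding free_smul_diff[symmetric] by (rule tensor_null_smul)

instance
proof
  fix t u s :: "('a, 'b) tensor" and c d :: kk
  note abs = plus_tensor.abs_eq zero_tensor_def uminus_tensor.abs_eq minus_tensor.abs_eq
    smul_tensor.abs_eq
  show "t + u + s = t + (u + s)"
    by (induction t rule: tensor.abs_induct, induction u rule: tensor.abs_induct,
        induction s rule: tensor.abs_induct) (simp only: abs add.assoc)
  show "t + u = u + t"
    by (induction t rule: tensor.abs_induct, induction u rule: tensor.abs_induct)
      (simp only: abs add.commute)
  show "0 + t = t"
    by (induction t rule: tensor.abs_induct) (simp only: abs add_0)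
  show "- t + t = 0"
    by (induction t rule: tensor.abs_induct) (simp only: abs add.left_inverse)
  show "t - u = t + - u"
    by (induction t rule: tensor.abs_induct, induction u rule: tensor.abs_induct)
      (simp only: abs diff_conv_add_uminus)
  show "c \<bullet>\<^sub>k (t + u) = c \<bullet>\<^sub>k t + c \<bullet>\<^sub>k u"
    by (induction t rule: tensor.abs_induct, induction u rule: tensor.abs_induct)
      (simp only: abs free_smul_add)
  have "free_smul (c + d) f = free_smul c f + free_smul d f"
      "free_smul c (free_smul d f) = free_smul (c * d) f" "free_smul 1 f = f"
    for f :: "'a \<times> 'b \<Rightarrow>\<^sub>0 kk"
    by (rule poly_mapping_eqI, simp add: lookup_add distrib_right)+
  note free = this
  show "(c + d) \<bullet>\<^sub>k t = c \<bullet>\<^sub>k t + d \<bullet>\<^sub>k t"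
    by (induction t rule: tensor.abs_induct) (simp only: abs free)
  show "c \<bullet>\<^sub>k d \<bullet>\<^sub>k t = (c * d) \<bullet>\<^sub>k t"
    by (induction t rule: tensor.abs_induct) (simp only: abs free)
  show "1 \<bullet>\<^sub>k t = t"
    by (induction t rule: tensor.abs_induct) (simp only: abs free)
qed

end

lift_definition pure_tensor :: "'a::kk_space \<Rightarrow> 'b::kk_space \<Rightarrow> ('a, 'b) tensor" (infixr "\<otimes>\<^sub>k" 76)
  is "\<lambda>v w. Poly_Mapping.single (v, w) 1" .

lemma pure_tensor_add_left: "(v + v') \<otimes>\<^sub>k w = v \<otimes>\<^sub>k w + v' \<otimes>\<^sub>k w"
  by transfer (simp add: diff_diff_eq[symmetric] tensor_null.add_left)

lemma pure_tensor_add_right: "v \<otimes>\<^sub>k (w + w') = v \<otimes>\<^sub>k w + v \<otimes>\<^sub>k w'"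
  by transfer (simp add: diff_diff_eq[symmetric] tensor_null.add_right)

lemma pure_tensor_smul_left: "(c \<bullet>\<^sub>k v) \<otimes>\<^sub>k w = c \<bullet>\<^sub>k (v \<otimes>\<^sub>k w)"
  using tensor_null.smul_left[of c v w 1] by transfer simp

lemma pure_tensor_smul_right: "v \<otimes>\<^sub>k (c \<bullet>\<^sub>k w) = c \<bullet>\<^sub>k (v \<otimes>\<^sub>k w)"
  using tensor_null.smul_right[of v c w 1] by transfer simp

lemma tensor_induct [case_names pure add]:
  assumes pure: "\<And>v w. P (v \<otimes>\<^sub>k w)" and add: "\<And>t u. P t \<Longrightarrow> P u \<Longrightarrow> P (t + u)"
  shows "P t"
proof -
  have "P (abs_tensor f)" for f
  proof (induction f rule: poly_mapping_free_induct)
    case zero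
    have "P ((0 :: 'a) \<otimes>\<^sub>k (0 :: 'b))" by (rule pure)
    also have "(0 :: 'a) \<otimes>\<^sub>k (0 :: 'b) = 0 \<bullet>\<^sub>k (0 \<otimes>\<^sub>k 0)"
      by (metis kk.scale_zero_left pure_tensor_smul_left)
    finally show ?case by (simp add: zero_tensor_def)
  next
    case (single x c)
    obtain v w where x: "x = (v, w)" by (cases x)
    have "abs_tensor (Poly_Mapping.single x c) = c \<bullet>\<^sub>k (v \<otimes>\<^sub>k w)"
      by (simp add: x smul_tensor.abs_eq pure_tensor.abs_eq)
    then show ?case by (metis pure pure_tensor_smul_left)
  next
    case (add f g)
    then show ?case using assms(2) by (metis plus_tensor.abs_eq)
  qed
  then show ?thesis by (induction t rule: tensor.abs_induct)
qed

definition bilin :: "('a::kk_space \<Rightarrow> 'b::kk_space \<Rightarrow> 'c::kk_space) \<Rightarrow> bool" where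
  "bilin b \<longleftrightarrow> (\<forall>w. kk_linear (\<lambda>v. b v w)) \<and> (\<forall>v. kk_linear (b v))"

text \<open>The linear map on the tensor product induced by a bilinear map; junk if \<open>b\<close> is not bilinear.\<close>

definition tensor_lift :: "('a::kk_space \<Rightarrow> 'b::kk_space \<Rightarrow> 'c::kk_space) \<Rightarrow> ('a, 'b) tensor \<Rightarrow> 'c" where
  "tensor_lift b t = free_lin (case_prod b) (rep_tensor t)"

lemma free_lin_tensor_null:
  assumes "bilin b" "f \<in> tensor_null"
  shows "free_lin (case_prod b) f = 0"
  using assms(2)
proof (induction rule: tensor_null.induct)
  have l: "kk_linear (\<lambda>v. b v w)" and r: "kk_linear (b v)" for v w
    using assms(1) by (auto simp: bilin_def)
  { case (add_left v v' w k)
    show ?case by (simp add: free_lin_diff kk_linear_add[OF l] smul_add_right)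
  next
    case (add_right v w w' k)
    show ?case by (simp add: free_lin_diff kk_linear_add[OF r] smul_add_right)
  next
    case (smul_left c v w k)
    show ?case by (simp add: free_lin_diff kk_linear_smul[OF l] smul_smul)
  next
    case (smul_right v c w k)
    show ?case by (simp add: free_lin_diff kk_linear_smul[OF r] smul_smul) }
qed (simp_all add: free_lin_add)

lemma tensor_lift_abs:
  assumes "bilin b"
  shows "tensor_lift b (abs_tensor f) = free_lin (case_prod b) f"
proof -
  have "rep_tensor (abs_tensor f) - f \<in> tensor_null"
    by (rule Quotient3_rep_abs[OF Quotient3_tensor]) (simp add: tensor_null.zero)
  from free_lin_tensor_null[OF assms this] show ?thesis
    by (simp add: tensor_lift_def free_lin_diff)
qed

lemma tensor_lift_pure: "bilin b \<Longrightarrow> tensor_lift b (v \<otimes>\<^sub>k w) = b v w"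
  by (simp add: pure_tensor.abs_eq tensor_lift_abs smul_one)

lemma linear_tensor_lift:
  assumes "bilin b"
  shows "kk_linear (tensor_lift b)"
proof (rule kk_linearI)
  fix t u :: "('a, 'b) tensor" and c
  show "tensor_lift b (t + u) = tensor_lift b t + tensor_lift b u"
    by (induction t rule: tensor.abs_induct, induction u rule: tensor.abs_induct)
      (simp add: plus_tensor.abs_eq tensor_lift_abs[OF assms] free_lin_add)
  show "tensor_lift b (c \<bullet>\<^sub>k t) = c \<bullet>\<^sub>k tensor_lift b t"
    by (induction t rule: tensor.abs_induct)
      (simp add: smul_tensor.abs_eq tensor_lift_abs[OF assms] free_lin_smul)
qed

definition tensor_map ::
  "('a::kk_space \<Rightarrow> 'c::kk_space) \<Rightarrow> ('b::kk_space \<Rightarrow> 'd::kk_space) \<Rightarrow> ('a, 'b) tensor \<Rightarrow> ('c, 'd) tensor" where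
  "tensor_map f g = tensor_lift (\<lambda>v w. f v \<otimes>\<^sub>k g w)"

lemma bilin_tensor_map: "kk_linear f \<Longrightarrow> kk_linear g \<Longrightarrow> bilin (\<lambda>v w. f v \<otimes>\<^sub>k g w)"
  by (auto simp: bilin_def kk_linear_add kk_linear_smul pure_tensor_add_left pure_tensor_add_right
      pure_tensor_smul_left pure_tensor_smul_right intro!: kk_linearI)

lemma tensor_map_pure:
  "kk_linear f \<Longrightarrow> kk_linear g \<Longrightarrow> tensor_map f g (v \<otimes>\<^sub>k w) = f v \<otimes>\<^sub>k g w"
  by (simp add: tensor_map_def tensor_lift_pure bilin_tensor_map)

lemma linear_tensor_map: "kk_linear f \<Longrightarrow> kk_linear g \<Longrightarrow> kk_linear (tensor_map f g)"
  by (simp add: tensor_map_def linear_tensor_lift bilin_tensor_map)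

instantiation tensor :: (superspace, superspace) superspace
begin

definition part_tensor :: "bit \<Rightarrow> ('a, 'b) tensor set" where
  "part p = kk.span {v \<otimes>\<^sub>k w | v w i j. v \<in> part i \<and> w \<in> part j \<and> i + j = p}"

instance
proof
  let ?b = "\<lambda>(v::'a) (w::'b). even_comp v \<otimes>\<^sub>k even_comp w + odd_comp v \<otimes>\<^sub>k odd_comp w"
  let ?E = "tensor_lift ?b"
  have b: "bilin ?b"
    using bilin_tensor_map[OF linear_even_comp linear_even_comp]
      bilin_tensor_map[OF linear_odd_comp linear_odd_comp]
    by (auto simp: bilin_def intro!: kk_linearI simp: kk_linear_add kk_linear_smul smul_add_right
        kk_linear_add[OF linear_even_comp] kk_linear_add[OF linear_odd_comp]
        kk_linear_smul[OF linear_even_comp] kk_linear_smul[OF linear_odd_comp]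
        pure_tensor_add_left pure_tensor_add_right pure_tensor_smul_left pure_tensor_smul_right)
  note E = linear_tensor_lift[OF b]
  have z1: "(0::'a) \<otimes>\<^sub>k (w::'b) = 0" for w
    by (metis kk.scale_zero_left pure_tensor_smul_left)
  have z2: "(v::'a) \<otimes>\<^sub>k (0::'b) = 0" for v
    by (metis kk.scale_zero_left pure_tensor_smul_right)
  have E0: "?E t = (if p = 0 then t else 0)" if "t \<in> part p" for p t
    using that unfolding part_tensor_def
  proof (induction rule: kk.span_induct_alt)
    case base
    show ?case by (simp add: kk_linear_zero[OF E])
  next
    case (step c x y)
    then obtain v w i j where x: "x = v \<otimes>\<^sub>k w" "v \<in> part i" "w \<in> part j" "i + j = p" by auto
    have "?E x = (if p = 0 then x else 0)"
      using x by (cases i; cases j)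
        (auto simp: tensor_lift_pure[OF b] even_comp_part odd_comp_part z1 z2)
    then show ?case using step by (simp add: kk_linear_add[OF E] kk_linear_smul[OF E])
  qed
  fix t :: "('a, 'b) tensor"
  show "\<exists>!u. u \<in> part 0 \<and> t - u \<in> part 1"
  proof (rule ex1I[of _ "?E t"])
    show "?E t \<in> part 0 \<and> t - ?E t \<in> part 1"
    proof (induction t rule: tensor_induct)
      case (pure v w)
      have "v \<otimes>\<^sub>k w = (even_comp v + odd_comp v) \<otimes>\<^sub>k (even_comp w + odd_comp w)"
        by (simp add: even_odd_comp)
      then have d: "v \<otimes>\<^sub>k w - ?E (v \<otimes>\<^sub>k w) = even_comp v \<otimes>\<^sub>k odd_comp w + odd_comp v \<otimes>\<^sub>k even_comp w"
        unfolding tensor_lift_pure[OF b]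
        by (simp only: pure_tensor_add_left pure_tensor_add_right) simp
      have e: "x \<otimes>\<^sub>k y \<in> part (i + j)" if "x \<in> part i" "y \<in> part j" for x :: 'a and y :: 'b and i j
        unfolding part_tensor_def using that by (intro kk.span_base) auto
      have "?E (v \<otimes>\<^sub>k w) \<in> part 0"
        using e[OF even_comp_in even_comp_in, of v w] e[OF odd_comp_in odd_comp_in, of v w]
        by (simp add: tensor_lift_pure[OF b] part_tensor_def kk.span_add)
      moreover have "v \<otimes>\<^sub>k w - ?E (v \<otimes>\<^sub>k w) \<in> part 1"
        unfolding d using e[OF even_comp_in odd_comp_in, of v w] e[OF odd_comp_in even_comp_in, of v w]
        by (simp add: part_tensor_def kk.span_add)
      ultimately show ?case by simp
    next
      case (add t u)
      have d: "t + u - ?E (t + u) = (t - ?E t) + (u - ?E u)"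
        by (simp add: kk_linear_add[OF E] add_diff_add)
      show ?case
        using add unfolding d unfolding kk_linear_add[OF E] part_tensor_def
        by (intro conjI kk.span_add) simp_all
    qed
  next
    fix u assume u: "u \<in> part 0 \<and> t - u \<in> part 1"
    then have "?E u = u" "?E (t - u) = 0" using E0 by fastforce+
    then show "u = ?E t" by (simp add: kk_linear_diff[OF E])
  qed
qed (simp_all add: part_tensor_def kk.span_zero kk.span_add kk.span_scale)

end


section \<open>Tensor products over an algebra\<close>

text \<open>Quotients are spaces of cosets inside a type, so they carry an explicit structure.\<close>

record 'v super_struct =
  sp_carrier :: "'v set"
  sp_add :: "'v \<Rightarrow> 'v \<Rightarrow> 'v"
  sp_smul :: "kk \<Rightarrow> 'v \<Rightarrow> 'v"
  sp_part :: "bit \<Rightarrow> 'v set"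

definition whole_space :: "'v::superspace super_struct" where
  "whole_space = \<lparr>sp_carrier = UNIV, sp_add = (+), sp_smul = smul, sp_part = part\<rparr>"

text \<open>In \<open>sp_smul\<close>, the summand \<open>N\<close> only matters for the scalar 0.\<close>

definition quotient_space :: "'v::superspace set \<Rightarrow> 'v set super_struct" where
  "quotient_space N = \<lparr>
     sp_carrier = {v +o N | v. True},
     sp_add = (\<lambda>A B. A + B),
     sp_smul = (\<lambda>c A. smul c ` A + N),
     sp_part = (\<lambda>p. {v +o N | v. v \<in> part p})\<rparr>"

definition super_iso :: "'v super_struct \<Rightarrow> 'w super_struct \<Rightarrow> ('v \<Rightarrow> 'w) \<Rightarrow> bool" where
  "super_iso S T \<phi> \<longleftrightarrow>
     bij_betw \<phi> (sp_carrier S) (sp_carrier T) \<and>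
     (\<forall>v\<in>sp_carrier S. \<forall>w\<in>sp_carrier S. \<phi> (sp_add S v w) = sp_add T (\<phi> v) (\<phi> w)) \<and>
     (\<forall>c. \<forall>v\<in>sp_carrier S. \<phi> (sp_smul S c v) = sp_smul T c (\<phi> v)) \<and>
     (\<forall>p. \<phi> ` sp_part S p = sp_part T p)"

definition super_isomorphic :: "'v super_struct \<Rightarrow> 'w super_struct \<Rightarrow> bool" (infix "\<simeq>\<^sub>s" 50) where
  "S \<simeq>\<^sub>s T \<longleftrightarrow> (\<exists>\<phi>. super_iso S T \<phi>)"

text \<open>\<open>V \<otimes>\<^sub>R L\<close> for a right action of \<open>R\<close> on \<open>V\<close> and a left action of \<open>R\<close> on \<open>L\<close>.\<close>

definition tensor_over ::
  "('v::superspace \<Rightarrow> 'r \<Rightarrow> 'v) \<Rightarrow> ('r \<Rightarrow> 'l::superspace \<Rightarrow> 'l) \<Rightarrow> ('v, 'l) tensor set super_struct" where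
  "tensor_over ract lact =
     quotient_space (kk.span {ract v r \<otimes>\<^sub>k l - v \<otimes>\<^sub>k lact r l | v r l. True})"


section \<open>The height one quiver Hecke--Clifford superalgebra\<close>

text \<open>The presentation does not depend on \<open>a\<close>; the generator \<open>Ge \<epsilon>\<close> stands for \<open>e(a, \<epsilon>)\<close>.\<close>

datatype gen = Ge bit | Gx | Gc

fun gen_parity :: "gen \<Rightarrow> bit" where
  "gen_parity (Ge \<epsilon>) = 0"
| "gen_parity Gx = 0"
| "gen_parity Gc = 1"

datatype gword = GWord (letters: "gen list")

instantiation gword :: monoid_add
begin
definition "0 = GWord []"
definition "u + w = GWord (letters u @ letters w)"
instance by standard (simp_all add: zero_gword_def plus_gword_def)
end

lemma letters_simps [simp]: "letters 0 = []" "letters (u + w) = letters u @ letters w"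
  by (simp_all add: zero_gword_def plus_gword_def)

text \<open>The free algebra on the generators, as the monoid algebra of words: multiplication is
  the convolution product of \<^typ>\<open>gword \<Rightarrow>\<^sub>0 kk\<close>.\<close>

type_synonym free_alg = "gword \<Rightarrow>\<^sub>0 kk"

definition gen_elt :: "gen \<Rightarrow> free_alg" where
  "gen_elt g = Poly_Mapping.single (GWord [g]) 1"

definition rc_relations :: "free_alg set" where
  "rc_relations =
     {gen_elt (Ge \<epsilon>) * gen_elt (Ge \<epsilon>) - gen_elt (Ge \<epsilon>) | \<epsilon>. True} \<union>
     {gen_elt (Ge \<epsilon>) * gen_elt (Ge (\<epsilon> + 1)) | \<epsilon>. True} \<union>
     {gen_elt (Ge 0) + gen_elt (Ge 1) - 1} \<union>
     {gen_elt Gx * gen_elt (Ge \<epsilon>) - gen_elt (Ge \<epsilon>) * gen_elt Gx | \<epsilon>. True} \<union>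
     {gen_elt Gc * gen_elt (Ge \<epsilon>) - gen_elt (Ge (\<epsilon> + 1)) * gen_elt Gc | \<epsilon>. True} \<union>
     {gen_elt Gc * gen_elt Gc - 1} \<union>
     {gen_elt Gc * gen_elt Gx + gen_elt Gx * gen_elt Gc}"

inductive_set rc_ideal :: "free_alg set" where
  rel: "f \<in> rc_relations \<Longrightarrow> f \<in> rc_ideal"
| zero: "0 \<in> rc_ideal"
| add: "f \<in> rc_ideal \<Longrightarrow> g \<in> rc_ideal \<Longrightarrow> f + g \<in> rc_ideal"
| mult_left: "f \<in> rc_ideal \<Longrightarrow> r * f \<in> rc_ideal"
| mult_right: "f \<in> rc_ideal \<Longrightarrow> f * r \<in> rc_ideal"

lemma rc_ideal_uminus: "f \<in> rc_ideal \<Longrightarrow> - f \<in> rc_ideal"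
  using rc_ideal.mult_left[of f "-1"] by simp

lemma rc_ideal_diff: "f \<in> rc_ideal \<Longrightarrow> g \<in> rc_ideal \<Longrightarrow> f - g \<in> rc_ideal"
  using rc_ideal.add[of f "- g"] rc_ideal_uminus[of g] by simp

quotient_type rc = free_alg / "\<lambda>f g. f - g \<in> rc_ideal"
proof (rule equivpI)
  show "reflp (\<lambda>f g. f - g \<in> rc_ideal)"
    by (rule reflpI) (simp add: rc_ideal.zero)
  show "symp (\<lambda>f g. f - g \<in> rc_ideal)"
    proof (rule sympI)
    fix f g :: free_alg
    assume "f - g \<in> rc_ideal"
    from rc_ideal_uminus[OF this] show "g - f \<in> rc_ideal" by simp
  qed
  show "transp (\<lambda>f g. f - g \<in> rc_ideal)"
    proof (rule transpI)
    fix f g h :: free_alg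
    assume "f - g \<in> rc_ideal" "g - h \<in> rc_ideal"
    from rc_ideal.add[OF this] show "f - h \<in> rc_ideal" by simp
  qed
qed

instantiation rc :: "{ring, monoid_mult}"
begin

lift_definition zero_rc :: rc is 0 .
lift_definition one_rc :: rc is 1 .

lift_definition plus_rc :: "rc \<Rightarrow> rc \<Rightarrow> rc" is "(+)"
  unfolding add_diff_add by (rule rc_ideal.add)

lift_definition uminus_rc :: "rc \<Rightarrow> rc" is uminus
  unfolding minus_diff_minus by (rule rc_ideal_uminus)

lift_definition minus_rc :: "rc \<Rightarrow> rc \<Rightarrow> rc" is "(-)"
proof -
  fix f f' g g' :: free_alg
  assume "f - f' \<in> rc_ideal" "g - g' \<in> rc_ideal"
  then have "(f - f') - (g - g') \<in> rc_ideal" by (rule rc_ideal_diff)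
  then show "(f - g) - (f' - g') \<in> rc_ideal" unfolding diff_diff_swap .
qed

lift_definition times_rc :: "rc \<Rightarrow> rc \<Rightarrow> rc" is "(*)"
proof -
  fix f f' g g' :: free_alg
  assume "f - f' \<in> rc_ideal" "g - g' \<in> rc_ideal"
  then have "(f - f') * g + f' * (g - g') \<in> rc_ideal"
    by (intro rc_ideal.add rc_ideal.mult_left rc_ideal.mult_right)
  then show "f * g - f' * g' \<in> rc_ideal" by (simp add: algebra_simps)
qed

instance
proof
  fix a b c :: rc
  have refl: "f = g \<Longrightarrow> f - g \<in> rc_ideal" for f g :: free_alg
    by (simp add: rc_ideal.zero)
  show "a + b + c = a + (b + c)" by transfer (rule refl, simp add: add.assoc)
  show "a + b = b + a" by transfer (rule refl, simp add: add.commute)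
  show "0 + a = a" by transfer (rule refl, simp)
  show "- a + a = 0" by transfer (rule refl, simp)
  show "a - b = a + - b" by transfer (rule refl, simp)
  show "a * b * c = a * (b * c)" by transfer (rule refl, simp add: mult.assoc)
  show "1 * a = a" by transfer (rule refl, simp)
  show "a * 1 = a" by transfer (rule refl, simp)
  show "(a + b) * c = a * c + b * c" by transfer (rule refl, simp add: algebra_simps)
  show "a * (b + c) = a * b + a * c" by transfer (rule refl, simp add: algebra_simps)
qed

end

definition rc_gen :: "gen \<Rightarrow> rc" where
  "rc_gen g = abs_rc (gen_elt g)"

definition rc_scalar :: "kk \<Rightarrow> rc" where
  "rc_scalar c = abs_rc (Poly_Mapping.single 0 c)"

definition rc_part :: "bit \<Rightarrow> rc set" where
  "rc_part p = {abs_rc f | f. \<forall>w\<in>Poly_Mapping.keys f. sum_list (map gen_parity (letters w)) = p}"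

lemma rc_gen_relations:
  "rc_gen (Ge \<epsilon>) * rc_gen (Ge \<epsilon>) = rc_gen (Ge \<epsilon>)"
  "rc_gen (Ge \<epsilon>) * rc_gen (Ge (\<epsilon> + 1)) = 0"
  "rc_gen (Ge 0) + rc_gen (Ge 1) = 1"
  "rc_gen Gx * rc_gen (Ge \<epsilon>) = rc_gen (Ge \<epsilon>) * rc_gen Gx"
  "rc_gen Gc * rc_gen (Ge \<epsilon>) = rc_gen (Ge (\<epsilon> + 1)) * rc_gen Gc"
  "rc_gen Gc * rc_gen Gc = 1"
  "rc_gen Gc * rc_gen Gx = - (rc_gen Gx * rc_gen Gc)"
  by (auto simp: rc_gen_def times_rc.abs_eq plus_rc.abs_eq zero_rc_def one_rc_def uminus_rc.abs_eq
      rc.abs_eq_iff rc_relations_def intro!: rc_ideal.rel)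

definition right_rc_supermodule :: "('v::superspace \<Rightarrow> rc \<Rightarrow> 'v) \<Rightarrow> bool" where
  "right_rc_supermodule act \<longleftrightarrow>
     (\<forall>r. kk_linear (\<lambda>v. act v r)) \<and>
     (\<forall>v r s. act v (r + s) = act v r + act v s) \<and>
     (\<forall>v r s. act v (r * s) = act (act v r) s) \<and>
     (\<forall>v c. act v (rc_scalar c) = c \<bullet>\<^sub>k v) \<and>
     (\<forall>p q. \<forall>v\<in>part p. \<forall>r\<in>rc_part q. act v r \<in> part (p + q))"

definition left_rc_supermodule :: "(rc \<Rightarrow> 'v::superspace \<Rightarrow> 'v) \<Rightarrow> bool" where
  "left_rc_supermodule act \<longleftrightarrow>
     (\<forall>r. kk_linear (act r)) \<and>
     (\<forall>v r s. act (r + s) v = act r v + act s v) \<and>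
     (\<forall>v r s. act (r * s) v = act r (act s v)) \<and>
     (\<forall>v c. act (rc_scalar c) v = c \<bullet>\<^sub>k v) \<and>
     (\<forall>p q. \<forall>v\<in>part p. \<forall>r\<in>rc_part q. act r v \<in> part (p + q))"

text \<open>Actions of the free algebra extending given operators of the generators.\<close>

definition free_ract :: "(gen \<Rightarrow> 'v::kk_space \<Rightarrow> 'v) \<Rightarrow> 'v \<Rightarrow> free_alg \<Rightarrow> 'v" where
  "free_ract ops v f = free_lin (\<lambda>w. fold ops (letters w) v) f"

definition free_lact :: "(gen \<Rightarrow> 'v::kk_space \<Rightarrow> 'v) \<Rightarrow> free_alg \<Rightarrow> 'v \<Rightarrow> 'v" where
  "free_lact ops f v = free_lin (\<lambda>w. foldr ops (letters w) v) f"

text \<open>The induced actions of the quotient algebra.  They are independent of the chosen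
  representative, and are module structures, when the operators are linear and satisfy the
  relations.\<close>

definition rc_ract :: "(gen \<Rightarrow> 'v::kk_space \<Rightarrow> 'v) \<Rightarrow> 'v \<Rightarrow> rc \<Rightarrow> 'v" where
  "rc_ract ops v r = free_ract ops v (rep_rc r)"

definition rc_lact :: "(gen \<Rightarrow> 'v::kk_space \<Rightarrow> 'v) \<Rightarrow> rc \<Rightarrow> 'v \<Rightarrow> 'v" where
  "rc_lact ops r v = free_lact ops (rep_rc r) v"

definition gen_ops :: "(gen \<Rightarrow> 'v::superspace \<Rightarrow> 'v) \<Rightarrow> bool" where
  "gen_ops ops \<longleftrightarrow> (\<forall>g. kk_linear (ops g) \<and> (\<forall>p. \<forall>v\<in>part p. ops g v \<in> part (p + gen_parity g)))"

lemma linear_free_lin: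
  assumes "\<And>x. kk_linear (\<lambda>v. h v x)"
  shows "kk_linear (\<lambda>v. free_lin (h v) f)"
  by (rule kk_linearI)
    (simp_all add: free_lin_def kk_linear_add[OF assms] kk_linear_smul[OF assms] smul_add_right
      sum.distrib kk.scale_sum_right mult.commute)

lemma linear_fold: "gen_ops ops \<Longrightarrow> kk_linear (\<lambda>v. fold ops gs v)"
proof (induction gs)
  case Nil
  show ?case by (rule kk_linearI) simp_all
next
  case (Cons g gs)
  note g = Cons.prems[unfolded gen_ops_def, rule_format, of g, THEN conjunct1]
  show ?case
    by (rule kk_linearI)
      (simp_all add: kk_linear_add[OF g] kk_linear_smul[OF g]
        kk_linear_add[OF Cons.IH[OF Cons.prems]] kk_linear_smul[OF Cons.IH[OF Cons.prems]])
qed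

lemma linear_foldr: "gen_ops ops \<Longrightarrow> kk_linear (\<lambda>v. foldr ops gs v)"
  using linear_fold[of ops "rev gs"] by (simp add: foldr_conv_fold)

lemma part_fold:
  "gen_ops ops \<Longrightarrow> v \<in> part p \<Longrightarrow> fold ops gs v \<in> part (p + sum_list (map gen_parity gs))"
proof (induction gs arbitrary: v p)
  case (Cons g gs)
  then have "ops g v \<in> part (p + gen_parity g)" by (auto simp: gen_ops_def)
  from Cons.IH[OF Cons.prems(1) this] show ?case
    by (simp only: fold_simps list.map sum_list.Cons add.assoc)
qed (simp only: fold_simps list.map sum_list.Nil add_0_right)

lemma sum_list_rev: "sum_list (rev xs) = sum_list (xs :: 'a::comm_monoid_add list)"
  by (induction xs) (simp_all add: add.commute)

lemma part_foldr:
  "gen_ops ops \<Longrightarrow> v \<in> part p \<Longrightarrow> foldr ops gs v \<in> part (p + sum_list (map gen_parity gs))"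
  using part_fold[of ops v p "rev gs"] by (simp add: foldr_conv_fold rev_map[symmetric] sum_list_rev)

lemma linear_free_ract: "gen_ops ops \<Longrightarrow> kk_linear (\<lambda>v. free_ract ops v f)"
  unfolding free_ract_def by (rule linear_free_lin) (rule linear_fold)

lemma linear_free_lact: "gen_ops ops \<Longrightarrow> kk_linear (free_lact ops f)"
  unfolding free_lact_def by (rule linear_free_lin) (rule linear_foldr)

lemma free_act_simps:
  "free_ract ops v (f + g) = free_ract ops v f + free_ract ops v g"
  "free_ract ops v (f - g) = free_ract ops v f - free_ract ops v g"
  "free_ract ops v (Poly_Mapping.single w c) = c \<bullet>\<^sub>k fold ops (letters w) v"
  "free_ract ops v 0 = 0"
  "free_lact ops (f + g) v = free_lact ops f v + free_lact ops g v"
  "free_lact ops (f - g) v = free_lact ops f v - free_lact ops g v"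
  "free_lact ops (Poly_Mapping.single w c) v = c \<bullet>\<^sub>k foldr ops (letters w) v"
  "free_lact ops 0 v = 0"
  by (simp_all add: free_ract_def free_lact_def free_lin_add free_lin_diff)

lemma free_ract_mult:
  assumes "gen_ops ops"
  shows "free_ract ops v (f * g) = free_ract ops (free_ract ops v f) g"
proof (induction f rule: poly_mapping_free_induct)
  case (single x c)
  show ?case
    by (induction g rule: poly_mapping_free_induct)
      (simp_all add: free_act_simps distrib_left mult_single kk_linear_smul[OF linear_fold[OF assms]]
        smul_smul mult.commute)
qed (simp_all add: free_act_simps distrib_right kk_linear_zero[OF linear_free_ract[OF assms]]
      kk_linear_add[OF linear_free_ract[OF assms]])

lemma free_lact_mult:
  assumes "gen_ops ops"
  shows "free_lact ops (f * g) v = free_lact ops f (free_lact ops g v)"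
proof (induction g rule: poly_mapping_free_induct)
  case (single x c)
  show ?case
    by (induction f rule: poly_mapping_free_induct)
      (simp_all add: free_act_simps distrib_right mult_single kk_linear_smul[OF linear_foldr[OF assms]]
        smul_smul mult.commute)
qed (simp_all add: free_act_simps distrib_left kk_linear_zero[OF linear_free_lact[OF assms]]
      kk_linear_add[OF linear_free_lact[OF assms]])

lemma free_ract_ideal:
  assumes ops: "gen_ops ops" and rel: "\<And>v f. f \<in> rc_relations \<Longrightarrow> free_ract ops v f = 0"
  shows "f \<in> rc_ideal \<Longrightarrow> free_ract ops v f = 0"
  by (induction arbitrary: v rule: rc_ideal.induct)
    (simp_all add: rel free_act_simps free_ract_mult[OF ops] kk_linear_zero[OF linear_free_ract[OF ops]])

lemma free_lact_ideal:
  assumes ops: "gen_ops ops" and rel: "\<And>v f. f \<in> rc_relations \<Longrightarrow> free_lact ops f v = 0"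
  shows "f \<in> rc_ideal \<Longrightarrow> free_lact ops f v = 0"
  by (induction arbitrary: v rule: rc_ideal.induct)
    (simp_all add: rel free_act_simps free_lact_mult[OF ops] kk_linear_zero[OF linear_free_lact[OF ops]])

lemma rep_abs_rc: "rep_rc (abs_rc f) - f \<in> rc_ideal"
  by (rule Quotient3_rep_abs[OF Quotient3_rc]) (simp add: rc_ideal.zero)

lemma rc_ract_abs:
  assumes "gen_ops ops" "\<And>v f. f \<in> rc_relations \<Longrightarrow> free_ract ops v f = 0"
  shows "rc_ract ops v (abs_rc f) = free_ract ops v f"
  using free_ract_ideal[OF assms rep_abs_rc, of v f] by (simp add: rc_ract_def free_act_simps)

lemma rc_lact_abs:
  assumes "gen_ops ops" "\<And>v f. f \<in> rc_relations \<Longrightarrow> free_lact ops f v = 0"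
  shows "rc_lact ops (abs_rc f) v = free_lact ops f v"
  using free_lact_ideal[OF assms rep_abs_rc, of f v] by (simp add: rc_lact_def free_act_simps)

lemma part_sum: "(\<And>x. x \<in> A \<Longrightarrow> f x \<in> part p) \<Longrightarrow> sum f A \<in> part p"
  by (induction A rule: infinite_finite_induct) (auto simp: part_zero part_add)

lemma right_rc_supermoduleI:
  assumes "gen_ops ops" "\<And>v f. f \<in> rc_relations \<Longrightarrow> free_ract ops v f = 0"
  shows "right_rc_supermodule (rc_ract ops)"
proof -
  note abs = rc_ract_abs[OF assms]
  have "rc_ract ops v r \<in> part (p + q)" if v: "v \<in> part p" and r: "r \<in> rc_part q" for v r p q
  proof -
    from r obtain f where f: "r = abs_rc f"
      "\<forall>w\<in>Poly_Mapping.keys f. sum_list (map gen_parity (letters w)) = q"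
      by (auto simp: rc_part_def)
    have "fold ops (letters w) v \<in> part (p + q)" if "w \<in> Poly_Mapping.keys f" for w
      using part_fold[OF assms(1) v, of "letters w"] f(2) that by simp
    then show ?thesis by (auto simp: f(1) abs free_ract_def free_lin_def intro!: part_sum part_smul)
  qed
  moreover have "rc_ract ops v (r + s) = rc_ract ops v r + rc_ract ops v s" for v r s
    by (induction r rule: rc.abs_induct, induction s rule: rc.abs_induct)
      (simp add: plus_rc.abs_eq abs free_act_simps)
  moreover have "rc_ract ops v (r * s) = rc_ract ops (rc_ract ops v r) s" for v r s
    by (induction r rule: rc.abs_induct, induction s rule: rc.abs_induct)
      (simp add: times_rc.abs_eq abs free_ract_mult[OF assms(1)])
  moreover have "kk_linear (\<lambda>v. rc_ract ops v r)" for r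
    unfolding rc_ract_def by (rule linear_free_ract[OF assms(1)])
  ultimately show ?thesis
    by (simp add: right_rc_supermodule_def rc_scalar_def abs free_act_simps)
qed

lemma left_rc_supermoduleI:
  assumes "gen_ops ops" "\<And>v f. f \<in> rc_relations \<Longrightarrow> free_lact ops f v = 0"
  shows "left_rc_supermodule (rc_lact ops)"
proof -
  note abs = rc_lact_abs[OF assms]
  have "rc_lact ops r v \<in> part (p + q)" if v: "v \<in> part p" and r: "r \<in> rc_part q" for v r p q
  proof -
    from r obtain f where f: "r = abs_rc f"
      "\<forall>w\<in>Poly_Mapping.keys f. sum_list (map gen_parity (letters w)) = q"
      by (auto simp: rc_part_def)
    have "foldr ops (letters w) v \<in> part (p + q)" if "w \<in> Poly_Mapping.keys f" for w
      using part_foldr[OF assms(1) v, of "letters w"] f(2) that by simp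
    then show ?thesis by (auto simp: f(1) abs free_lact_def free_lin_def intro!: part_sum part_smul)
  qed
  moreover have "rc_lact ops (r + s) v = rc_lact ops r v + rc_lact ops s v" for v r s
    by (induction r rule: rc.abs_induct, induction s rule: rc.abs_induct)
      (simp add: plus_rc.abs_eq abs free_act_simps)
  moreover have "rc_lact ops (r * s) v = rc_lact ops r (rc_lact ops s v)" for v r s
    by (induction r rule: rc.abs_induct, induction s rule: rc.abs_induct)
      (simp add: times_rc.abs_eq abs free_lact_mult[OF assms(1)])
  moreover have "kk_linear (rc_lact ops r)" for r
    unfolding rc_lact_def by (rule linear_free_lact[OF assms(1)])
  ultimately show ?thesis
    by (simp add: left_rc_supermodule_def rc_scalar_def abs free_act_simps)
qed

lemma gen_elt_mult: "gen_elt g * gen_elt h = Poly_Mapping.single (GWord [g, h]) 1"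
  by (simp add: gen_elt_def mult_single plus_gword_def)

lemma free_act_one: "free_ract ops v 1 = v" "free_lact ops 1 v = v"
  by (simp_all add: free_act_simps smul_one flip: single_one)

lemma free_act_gen: "free_ract ops v (gen_elt g) = ops g v" "free_lact ops (gen_elt g) v = ops g v"
  by (simp_all add: gen_elt_def free_act_simps smul_one)

lemma free_ract_relationsI:
  assumes "\<And>\<epsilon> v. ops (Ge \<epsilon>) (ops (Ge \<epsilon>) v) = ops (Ge \<epsilon>) v"
    and "\<And>\<epsilon> v. ops (Ge (\<epsilon> + 1)) (ops (Ge \<epsilon>) v) = 0"
    and "\<And>v. ops (Ge 0) v + ops (Ge 1) v = v"
    and "\<And>\<epsilon> v. ops (Ge \<epsilon>) (ops Gx v) = ops Gx (ops (Ge \<epsilon>) v)"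
    and "\<And>\<epsilon> v. ops (Ge \<epsilon>) (ops Gc v) = ops Gc (ops (Ge (\<epsilon> + 1)) v)"
    and "\<And>v. ops Gc (ops Gc v) = v"
    and "\<And>v. ops Gx (ops Gc v) = - ops Gc (ops Gx v)"
  shows "f \<in> rc_relations \<Longrightarrow> free_ract ops v f = 0"
  unfolding rc_relations_def
  by (auto simp: free_act_simps free_act_one free_act_gen gen_elt_mult smul_one assms
      assms(2)[of 0, simplified] assms(2)[of 1, simplified])

lemma free_lact_relationsI:
  assumes "\<And>\<epsilon> v. ops (Ge \<epsilon>) (ops (Ge \<epsilon>) v) = ops (Ge \<epsilon>) v"
    and "\<And>\<epsilon> v. ops (Ge \<epsilon>) (ops (Ge (\<epsilon> + 1)) v) = 0"
    and "\<And>v. ops (Ge 0) v + ops (Ge 1) v = v"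
    and "\<And>\<epsilon> v. ops Gx (ops (Ge \<epsilon>) v) = ops (Ge \<epsilon>) (ops Gx v)"
    and "\<And>\<epsilon> v. ops Gc (ops (Ge \<epsilon>) v) = ops (Ge (\<epsilon> + 1)) (ops Gc v)"
    and "\<And>v. ops Gc (ops Gc v) = v"
    and "\<And>v. ops Gc (ops Gx v) = - ops Gx (ops Gc v)"
  shows "f \<in> rc_relations \<Longrightarrow> free_lact ops f v = 0"
  unfolding rc_relations_def
  by (auto simp: free_act_simps free_act_one free_act_gen gen_elt_mult smul_one assms
      assms(2)[of 0, simplified] assms(2)[of 1, simplified])


section \<open>The segment module of length one\<close>

text \<open>\<open>LMod b\<close> is \<open>b 0 u\<^sub>0 + b 1 u\<^sub>1\<close>.\<close>

datatype lmod = LMod (ucoeff: "bit \<Rightarrow> kk")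

instantiation lmod :: superspace
begin
definition "0 = LMod 0"
definition "l + l' = LMod (ucoeff l + ucoeff l')"
definition "- l = LMod (- ucoeff l)"
definition "l - l' = LMod (ucoeff l - ucoeff l')"
definition "c \<bullet>\<^sub>k l = LMod (\<lambda>j. c * ucoeff l j)"
definition "part p = {l. \<forall>j. j \<noteq> p \<longrightarrow> ucoeff l j = 0}"
instance
proof
  fix l :: lmod
  show "\<exists>!w. w \<in> part 0 \<and> l - w \<in> part 1"
    by (rule ex1I[of _ "LMod (\<lambda>j. if j = 0 then ucoeff l j else 0)"])
      (auto simp: part_lmod_def minus_lmod_def intro!: lmod.expand ext)
qed (auto simp: zero_lmod_def plus_lmod_def uminus_lmod_def minus_lmod_def smul_lmod_def part_lmod_def
      fun_eq_iff algebra_simps)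
end

lemma ucoeff_simps [simp]:
  "ucoeff 0 j = 0" "ucoeff (l + l') j = ucoeff l j + ucoeff l' j" "ucoeff (- l) j = - ucoeff l j"
  "ucoeff (l - l') j = ucoeff l j - ucoeff l' j" "ucoeff (c \<bullet>\<^sub>k l) j = c * ucoeff l j"
  by (simp_all add: zero_lmod_def plus_lmod_def uminus_lmod_def minus_lmod_def smul_lmod_def)

definition uvec :: "bit \<Rightarrow> lmod" where
  "uvec j = LMod (\<lambda>i. if i = j then 1 else 0)"

fun L_op :: "gen \<Rightarrow> lmod \<Rightarrow> lmod" where
  "L_op (Ge \<epsilon>) l = LMod (\<lambda>j. if j = \<epsilon> then ucoeff l j else 0)"
| "L_op Gx l = 0"
| "L_op Gc l = LMod (\<lambda>j. ucoeff l (j + 1))"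

lemma L_op_uvec:
  "L_op (Ge \<epsilon>) (uvec j) = (if \<epsilon> = j then uvec j else 0)" "L_op Gx (uvec j) = 0"
  "L_op Gc (uvec 0) = uvec 1" "L_op Gc (uvec 1) = uvec 0"
  by (auto simp: uvec_def zero_lmod_def fun_eq_iff split: bit.splits)

definition L_act :: "rc \<Rightarrow> lmod \<Rightarrow> lmod" where
  "L_act = rc_lact L_op"

lemma bit_add_1_eq_iff: "i + 1 = j \<longleftrightarrow> i \<noteq> (j :: bit)"
  by (cases i; cases j) auto

lemma gen_ops_L_op: "gen_ops L_op"
proof -
  have "kk_linear (L_op g)" for g
    by (cases g) (auto intro!: kk_linearI lmod.expand ext)
  moreover have "L_op g v \<in> part (p + gen_parity g)" if "v \<in> part p" for g p v
    using that by (cases g) (auto simp: part_lmod_def bit_add_1_eq_iff)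
  ultimately show ?thesis by (simp add: gen_ops_def)
qed

lemma L_relations: "f \<in> rc_relations \<Longrightarrow> free_lact L_op f v = 0"
  by (rule free_lact_relationsI)
    (auto intro!: lmod.expand ext simp: bit_add_1_eq_iff add.assoc)

lemma left_rc_supermodule_L: "left_rc_supermodule L_act"
  unfolding L_act_def by (rule left_rc_supermoduleI[OF gen_ops_L_op L_relations])

lemma L_act_gen: "L_act (rc_gen g) l = L_op g l"
  by (simp add: L_act_def rc_gen_def free_act_gen rc_lact_abs[OF gen_ops_L_op L_relations])

instance rc :: ring_1
proof
  have "L_act (rc_scalar 1) (uvec 0) = uvec 0" "L_act (rc_scalar 0) (uvec 0) = 0"
    using left_rc_supermodule_L by (simp_all add: left_rc_supermodule_def smul_one)
  moreover have "rc_scalar 1 = 1" "rc_scalar 0 = 0"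
    by (simp_all add: rc_scalar_def one_rc_def zero_rc_def)
  moreover have "uvec 0 \<noteq> 0" by (simp add: uvec_def zero_lmod_def fun_eq_iff)
  ultimately show "(0 :: rc) \<noteq> 1" by metis
qed


section \<open>The completed bimodules\<close>

text \<open>The superspace \<open>\<W>\<^bsub>1,\<epsilon>\<^esub>\<close> with even coordinates \<open>comps v 0\<close> and odd ones
  \<open>comps v 1\<close>; \<open>M\<close> is the cardinality of the index type.\<close>

datatype ('m::finite) svec = SVec (comps: "bit \<Rightarrow> kk ^ 'm")

instantiation svec :: (finite) superspace
begin
definition "0 = SVec 0"
definition "v + w = SVec (comps v + comps w)"
definition "- v = SVec (- comps v)"
definition "v - w = SVec (comps v - comps w)"
definition "c \<bullet>\<^sub>k v = SVec (\<lambda>j. c *s comps v j)"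
definition "part p = {v. \<forall>j. j \<noteq> p \<longrightarrow> comps v j = 0}"
instance
proof
  fix v :: "'a svec"
  show "\<exists>!w. w \<in> part 0 \<and> v - w \<in> part 1"
    by (rule ex1I[of _ "SVec (\<lambda>j. if j = 0 then comps v j else 0)"])
      (auto simp: part_svec_def minus_svec_def intro!: svec.expand ext)
qed (auto simp: zero_svec_def plus_svec_def uminus_svec_def minus_svec_def smul_svec_def part_svec_def
      fun_eq_iff vec_eq_iff algebra_simps)
end

text \<open>An element of \<open>\<k>[[z - c]]\<close> is stored as its expansion in the local coordinate
  \<open>z - c\<close>; the type does not record the centre \<open>c\<close>.\<close>

datatype pseries = PSeries (expansion: "kk fps")

instantiation pseries :: superspace
begin
definition "0 = PSeries 0"
definition "f + g = PSeries (expansion f + expansion g)"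
definition "- f = PSeries (- expansion f)"
definition "f - g = PSeries (expansion f - expansion g)"
definition "c \<bullet>\<^sub>k f = PSeries (fps_const c * expansion f)"
definition "part p = (if p = 0 then UNIV else {0 :: pseries})"
instance
proof
  fix f :: pseries
  show "\<exists>!w. w \<in> part 0 \<and> f - w \<in> part 1"
    by (rule ex1I[of _ f])
      (auto simp: part_pseries_def minus_pseries_def zero_pseries_def intro!: pseries.expand)
qed (auto simp: zero_pseries_def plus_pseries_def uminus_pseries_def minus_pseries_def smul_pseries_def
      part_pseries_def algebra_simps simp flip: fps_const_add fps_const_mult split: if_splits)
end

lemma expansion_simps [simp]:
  "expansion 0 = 0" "expansion (f + g) = expansion f + expansion g" "expansion (- f) = - expansion f"
  "expansion (f - g) = expansion f - expansion g" "expansion (c \<bullet>\<^sub>k f) = fps_const c * expansion f"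
  by (simp_all add: zero_pseries_def plus_pseries_def uminus_pseries_def minus_pseries_def smul_pseries_def)

datatype flavour = Prime | Twist

fun centre :: "flavour \<Rightarrow> int \<Rightarrow> bit \<Rightarrow> kk" where
  "centre Prime a \<epsilon> = qq powi (- 2 * a)"
| "centre Twist a \<epsilon> = qq powi (- sgn2 \<epsilon> * 2 * a)"

lemma centre_nonzero [simp]: "centre fl a \<epsilon> \<noteq> 0"
  by (cases fl) simp_all

text \<open>The function \<open>z\<close>, expanded at \<open>c\<close>.\<close>

definition z_at :: "kk \<Rightarrow> kk fps" where
  "z_at c = fps_const c + fps_X"

fun x_series :: "flavour \<Rightarrow> int \<Rightarrow> bit \<Rightarrow> kk fps" where
  "x_series Prime a \<epsilon> =
     (let c = centre Prime a \<epsilon> in (z_at c - fps_const c) / fps_const c)"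
| "x_series Twist a \<epsilon> =
     (let c = centre Twist a \<epsilon> in (z_at c - fps_const c) / (z_at c + fps_const c))"

text \<open>\<open>theta fl a \<epsilon>\<close> maps expansions at \<open>centre fl a \<epsilon>\<close> to expansions at
  \<open>centre fl a (\<epsilon> + 1)\<close>.  For the twisted flavour, \<open>z\<^sup>-\<^sup>1\<close> is expanded at the new centre, and
  \<open>z\<^sup>-\<^sup>1\<close> minus the old centre is substituted for the local coordinate at the old centre; its
  constant term vanishes because the two centres are mutually inverse.\<close>

fun theta :: "flavour \<Rightarrow> int \<Rightarrow> bit \<Rightarrow> pseries \<Rightarrow> pseries" where
  "theta Prime a \<epsilon> f = f"
| "theta Twist a \<epsilon> f = PSeries (fps_compose (expansion f)
     (inverse (z_at (centre Twist a (\<epsilon> + 1))) - fps_const (centre Twist a \<epsilon>)))"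

definition pseries_mult :: "kk fps \<Rightarrow> pseries \<Rightarrow> pseries" where
  "pseries_mult x f = PSeries (x * expansion f)"

type_synonym 'm VO = "bit \<Rightarrow> (pseries, 'm svec) tensor"

definition summand :: "bit \<Rightarrow> 'v \<Rightarrow> bit \<Rightarrow> 'v::zero" where
  "summand \<epsilon> t = (\<lambda>j. if j = \<epsilon> then t else 0)"

text \<open>The right action of the generators.  The argument \<open>s\<close> is the sign in front of
  \<open>x\<^sub>\<epsilon>\<close> in the action of \<open>Gx\<close>.\<close>

fun V_op :: "(bit \<Rightarrow> kk) \<Rightarrow> flavour \<Rightarrow> int \<Rightarrow> ('m::finite svec \<Rightarrow> 'm svec) \<Rightarrow> gen \<Rightarrow> 'm VO \<Rightarrow> 'm VO" where
  "V_op s fl a P (Ge \<epsilon>) F = summand \<epsilon> (F \<epsilon>)"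
| "V_op s fl a P Gx F = (\<lambda>\<epsilon>. s \<epsilon> \<bullet>\<^sub>k tensor_map (pseries_mult (x_series fl a \<epsilon>)) (\<lambda>v. v) (F \<epsilon>))"
| "V_op s fl a P Gc F = (\<lambda>\<epsilon>. sqrt_m1 \<bullet>\<^sub>k
     tensor_map (theta fl a (\<epsilon> + 1)) (\<lambda>v. P (parity_inv v)) (F (\<epsilon> + 1)))"

lemma linear_id_kk: "kk_linear (\<lambda>v. v)"
  by (rule kk_linearI) simp_all

lemma linear_pseries_mult: "kk_linear (pseries_mult x)"
  by (rule kk_linearI) (simp_all add: pseries_mult_def pseries.expand algebra_simps)

lemma linear_theta: "kk_linear (theta fl a \<epsilon>)"
proof (cases fl)
  case Prime
  then show ?thesis by (intro kk_linearI) simp_all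
next
  case Twist
  show ?thesis unfolding Twist
  proof (rule kk_linearI)
    fix f g and c
    show "theta Twist a \<epsilon> (f + g) = theta Twist a \<epsilon> f + theta Twist a \<epsilon> g"
      by (rule pseries.expand) (simp add: fps_compose_add_distrib)
    have "fps_compose (fps_const c * expansion f) h = fps_const c * fps_compose (expansion f) h" for h
      by (simp add: fps_eq_iff fps_compose_nth sum_distrib_left mult.assoc)
    then show "theta Twist a \<epsilon> (c \<bullet>\<^sub>k f) = c \<bullet>\<^sub>k theta Twist a \<epsilon> f"
      by (intro pseries.expand) simp
  qed
qed

lemma V_op_pure_Gx:
  "V_op s fl a P Gx (summand \<epsilon> (f \<otimes>\<^sub>k v)) =
     summand \<epsilon> (s \<epsilon> \<bullet>\<^sub>k (PSeries (x_series fl a \<epsilon> * expansion f) \<otimes>\<^sub>k v))"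
  by (rule ext)
    (simp add: summand_def tensor_map_pure[OF linear_pseries_mult linear_id_kk] pseries_mult_def
      kk_linear_zero[OF linear_tensor_map[OF linear_pseries_mult linear_id_kk]])

lemma linear_P_parity_inv: "kk_linear P \<Longrightarrow> kk_linear (\<lambda>v. P (parity_inv v))"
  by (rule kk_linearI)
    (simp_all add: kk_linear_add[OF linear_parity_inv] kk_linear_smul[OF linear_parity_inv]
      kk_linear_add kk_linear_smul)

lemma V_op_pure_Gc:
  assumes "kk_linear P" "v \<in> part p"
  shows "V_op s fl a P Gc (summand \<epsilon> (f \<otimes>\<^sub>k v)) =
     summand (\<epsilon> + 1) ((sgn2 p * sqrt_m1) \<bullet>\<^sub>k (theta fl a \<epsilon> f \<otimes>\<^sub>k P v))"
proof (rule ext)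
  fix j
  note l = linear_theta linear_P_parity_inv[OF assms(1)]
  have "(j + 1 = \<epsilon>) = (j = \<epsilon> + 1)" by (cases j; cases \<epsilon>) auto
  then show "V_op s fl a P Gc (summand \<epsilon> (f \<otimes>\<^sub>k v)) j =
     summand (\<epsilon> + 1) ((sgn2 p * sqrt_m1) \<bullet>\<^sub>k (theta fl a \<epsilon> f \<otimes>\<^sub>k P v)) j"
    by (auto simp: summand_def tensor_map_pure[OF l] kk_linear_zero[OF linear_tensor_map[OF l]]
        parity_inv_part[OF assms(2)] kk_linear_smul[OF assms(1)] pure_tensor_smul_right mult.commute)
qed

text \<open>For the twisted flavour the relation \<open>c x = - x c\<close> already holds without the sign
  \<open>(-1)\<^sup>\<epsilon>\<close>, since \<open>theta\<close> maps \<open>x\<^sub>\<epsilon>\<close> to \<open>- x\<^bsub>1-\<epsilon>\<^esub>\<close>; with the sign, \<open>c\<close> and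
  \<open>x\<close> would commute (\<open>twist_signed_commute\<close> below).\<close>

fun x_sign :: "flavour \<Rightarrow> bit \<Rightarrow> kk" where
  "x_sign Prime \<epsilon> = sgn2 \<epsilon>"
| "x_sign Twist \<epsilon> = 1"

definition V_act :: "flavour \<Rightarrow> int \<Rightarrow> ('m::finite svec \<Rightarrow> 'm svec) \<Rightarrow> 'm VO \<Rightarrow> rc \<Rightarrow> 'm VO" where
  "V_act fl a P = rc_ract (V_op (x_sign fl) fl a P)"

lemma centre_mult: "centre Twist a (\<epsilon> + 1) * centre Twist a \<epsilon> = 1"
  by (cases \<epsilon>) (simp_all add: sgn2_def flip: power_int_add)

lemma theta_theta: "theta fl a (\<epsilon> + 1) (theta fl a \<epsilon> f) = f"
proof (cases fl)
  case Twist
  define c d where "c = centre Twist a \<epsilon>" and "d = centre Twist a (\<epsilon> + 1)"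
  have cd: "d * c = 1" "inverse c = d" "inverse d = c"
    using centre_mult[of a \<epsilon>] by (auto simp: c_def d_def field_simps)
  have n: "c \<noteq> 0" "d \<noteq> 0" by (auto simp: c_def d_def)
  let ?s = "inverse (z_at d) - fps_const c" and ?t = "inverse (z_at c) - fps_const d"
  have z: "?s $ 0 = 0" "?t $ 0 = 0" by (simp_all add: z_at_def cd)
  have "fps_compose (z_at d) ?t = inverse (z_at c)"
    by (simp add: z_at_def fps_compose_add_distrib fps_X_fps_compose_startby0[OF z(2), unfolded z_at_def])
  then have "fps_compose (inverse (z_at d)) ?t = z_at c"
    using n z by (subst fps_inverse_compose) (simp_all add: z_at_def)
  then have st: "fps_compose ?s ?t = fps_X"
    by (simp add: fps_compose_sub_distrib z_at_def)
  have "(\<epsilon> + 1) + 1 = \<epsilon>" by (cases \<epsilon>) auto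
  then have "expansion (theta Twist a (\<epsilon> + 1) (theta Twist a \<epsilon> f)) =
      fps_compose (fps_compose (expansion f) ?s) ?t"
    by (simp only: theta.simps pseries.sel c_def d_def)
  also have "\<dots> = expansion f"
    using fps_compose_assoc[OF z(2,1), of "expansion f"] st by simp
  finally have "expansion (theta Twist a (\<epsilon> + 1) (theta Twist a \<epsilon> f)) = expansion f" .
  then show ?thesis unfolding Twist by (rule pseries.expand)
qed simp

lemma theta_x_twist:
  "theta Twist a \<epsilon> (pseries_mult (x_series Twist a \<epsilon>) f) =
     - pseries_mult (x_series Twist a (\<epsilon> + 1)) (theta Twist a \<epsilon> f)"
proof -
  define c d where "c = centre Twist a \<epsilon>" and "d = centre Twist a (\<epsilon> + 1)"
  have cd: "d * c = 1" "inverse c = d" "inverse d = c"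
    using centre_mult[of a \<epsilon>] by (auto simp: c_def d_def field_simps)
  have n: "c \<noteq> 0" "d \<noteq> 0" by (auto simp: c_def d_def)
  let ?s = "inverse (z_at d) - fps_const c"
  let ?i = "inverse (z_at d)"
  have s0: "?s $ 0 = 0" by (simp add: z_at_def cd)
  have x: "x_series Twist a \<epsilon> = fps_X * inverse (z_at c + fps_const c)"
    "x_series Twist a (\<epsilon> + 1) = fps_X * inverse (z_at d + fps_const d)"
    using n unfolding c_def d_def
    by (simp_all add: Let_def z_at_def fps_divide_unit del: centre.simps)
  have zd: "z_at d * ?i = 1"
    using n by (intro inverse_mult_eq_1') (simp add: z_at_def)
  have u: "(?i + fps_const c) $ 0 \<noteq> 0" using n by (simp add: z_at_def cd)
  have u': "(z_at d + fps_const d) $ 0 \<noteq> 0" using n by (simp add: z_at_def)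
  have "fps_compose (z_at c) ?s = ?i"
    by (simp add: z_at_def fps_compose_add_distrib fps_X_fps_compose_startby0[OF s0, unfolded z_at_def])
  then have "fps_compose (z_at c + fps_const c) ?s = ?i + fps_const c"
    by (simp only: fps_compose_add_distrib fps_const_compose)
  then have i: "fps_compose (inverse (z_at c + fps_const c)) ?s = inverse (?i + fps_const c)"
    using n s0 by (subst fps_inverse_compose) (simp_all add: z_at_def)
  have cd1: "fps_const c * fps_const d = 1" "fps_const d * fps_const c = 1"
    using cd(1) by (simp_all add: mult.commute)
  have e1: "fps_const c * (z_at d + fps_const d) = z_at d * (?i + fps_const c)"
    unfolding distrib_left cd1 zd by (simp only: mult.commute add.commute)
  have zc: "z_at d * fps_const c = 1 + fps_const c * fps_X"
    unfolding z_at_def distrib_right cd1 by (simp only: mult.commute)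
  have e2: "fps_const c * fps_X = - (z_at d * ?s)"
    unfolding right_diff_distrib zd zc by simp
  have "?s * inverse (?i + fps_const c) = - (fps_X * inverse (z_at d + fps_const d))"
  proof -
    have "fps_const c * (?s * inverse (?i + fps_const c) * ((z_at d + fps_const d) * (?i + fps_const c))) =
      fps_const c * (- (fps_X * inverse (z_at d + fps_const d)) * ((z_at d + fps_const d) * (?i + fps_const c)))"
    proof -
      have "?s * inverse (?i + fps_const c) * ((z_at d + fps_const d) * (?i + fps_const c)) =
          ?s * (z_at d + fps_const d) * (inverse (?i + fps_const c) * (?i + fps_const c))"
        by (simp only: mult_ac)
      also have "\<dots> = ?s * (z_at d + fps_const d)" using inverse_mult_eq_1[OF u] by simp
      finally have l: "fps_const c * (?s * inverse (?i + fps_const c) *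
          ((z_at d + fps_const d) * (?i + fps_const c))) =
          ?s * (fps_const c * (z_at d + fps_const d))" by (simp only: mult_ac)
      have "- (fps_X * inverse (z_at d + fps_const d)) * ((z_at d + fps_const d) * (?i + fps_const c)) =
          - fps_X * (?i + fps_const c) * (inverse (z_at d + fps_const d) * (z_at d + fps_const d))"
        by (simp only: mult_ac mult_minus_left mult_minus_right)
      also have "\<dots> = - fps_X * (?i + fps_const c)" using inverse_mult_eq_1[OF u'] by simp
      finally have r: "fps_const c * (- (fps_X * inverse (z_at d + fps_const d)) *
          ((z_at d + fps_const d) * (?i + fps_const c))) = - (fps_const c * fps_X) * (?i + fps_const c)"
        by (simp only: mult_ac mult_minus_left mult_minus_right)
      show ?thesis unfolding l r e1 e2 by (simp only: mult_ac minus_minus)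
    qed
    moreover have "z_at d + fps_const d \<noteq> 0" "?i + fps_const c \<noteq> 0"
      using u u' by (metis fps_zero_nth)+
    moreover have "fps_const c \<noteq> 0" using n by simp
    ultimately show ?thesis by (simp only: mult_cancel_left mult_cancel_right mult_eq_0_iff) simp
  qed
  then have "fps_compose (x_series Twist a \<epsilon>) ?s = - x_series Twist a (\<epsilon> + 1)"
    by (simp only: x fps_compose_mult_distrib[OF s0] i fps_X_fps_compose_startby0[OF s0])
  then have "fps_compose (x_series Twist a \<epsilon> * expansion f) ?s =
      - (x_series Twist a (\<epsilon> + 1) * fps_compose (expansion f) ?s)"
    by (simp only: fps_compose_mult_distrib[OF s0] mult_minus_left)
  then show ?thesis
    by (intro pseries.expand) (simp add: pseries_mult_def c_def d_def del: x_series.simps)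
qed

lemma tensor_map_comp:
  assumes "kk_linear f" "kk_linear g" "kk_linear f'" "kk_linear g'"
  shows "tensor_map f g (tensor_map f' g' t) = tensor_map (\<lambda>v. f (f' v)) (\<lambda>w. g (g' w)) t"
proof -
  have c: "kk_linear (\<lambda>v. f (f' v))" "kk_linear (\<lambda>w. g (g' w))"
    using assms by (auto intro!: kk_linearI simp: kk_linear_add kk_linear_smul)
  show ?thesis
    by (induction t rule: tensor_induct)
      (simp_all add: tensor_map_pure assms c kk_linear_add[OF linear_tensor_map[OF assms(1,2)]]
        kk_linear_add[OF linear_tensor_map[OF assms(3,4)]] kk_linear_add[OF linear_tensor_map[OF c]])
qed

lemma part_tensor_map:
  assumes "kk_linear f" "kk_linear g" "\<And>i v. v \<in> part i \<Longrightarrow> f v \<in> part i"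
    "\<And>j w. w \<in> part j \<Longrightarrow> g w \<in> part (j + d)" "t \<in> part p"
  shows "tensor_map f g t \<in> part (p + d)"
  using assms(5) unfolding part_tensor_def[of p]
proof (induction rule: kk.span_induct_alt)
  case base
  show ?case by (simp only: kk_linear_zero[OF linear_tensor_map[OF assms(1,2)]] part_zero)
next
  case (step c x y)
  then obtain v w i j where x: "x = v \<otimes>\<^sub>k w" "v \<in> part i" "w \<in> part j" "i + j = p" by auto
  have "i + (j + d) = p + d" using x(4) by (simp only: add.assoc[symmetric])
  then have "tensor_map f g x \<in> part (p + d)"
    unfolding x(1) tensor_map_pure[OF assms(1,2)] part_tensor_def
    using assms(3)[OF x(2)] assms(4)[OF x(3)] by (intro kk.span_base) blast
  then show ?case
    using step(2) unfolding kk_linear_add[OF linear_tensor_map[OF assms(1,2)]]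
      kk_linear_smul[OF linear_tensor_map[OF assms(1,2)]]
    by (intro part_add part_smul)
qed

lemma parity_inv_odd:
  assumes "kk_linear P" "odd_map P"
  shows "parity_inv (P v) = - P (parity_inv v)"
proof -
  have P: "P w \<in> part (p + 1)" if "w \<in> part p" for w p using assms(2) that by (auto simp: odd_map_def)
  have "P v = P (even_comp v) + P (odd_comp v)"
    by (metis assms(1) even_odd_comp kk_linear_add)
  then have "parity_inv (P v) = parity_inv (P (even_comp v)) + parity_inv (P (odd_comp v))"
    by (simp add: kk_linear_add[OF linear_parity_inv])
  also have "\<dots> = - P (even_comp v) + P (odd_comp v)"
    using parity_inv_part[OF P[OF even_comp_in[of v]]] parity_inv_part[OF P[OF odd_comp_in[of v]]]
    by (simp add: sgn2_def)
  finally show ?thesis by (simp add: parity_inv_def kk_linear_diff[OF assms(1)])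
qed

lemma parity_inv_inv: "parity_inv (parity_inv v) = v"
proof -
  have "parity_inv (parity_inv v) = parity_inv (even_comp v) - parity_inv (odd_comp v)"
    by (simp only: parity_inv_def[of v] kk_linear_diff[OF linear_parity_inv])
  then show ?thesis
    by (simp add: parity_inv_part[OF even_comp_in] parity_inv_part[OF odd_comp_in] sgn2_def even_odd_comp)
qed

lemma gen_ops_V_op:
  assumes "kk_linear P" "odd_map P"
  shows "gen_ops (V_op s fl a P)"
proof -
  note x = linear_pseries_mult linear_id_kk
  note c = linear_theta linear_P_parity_inv[OF assms(1)]
  have "kk_linear (V_op s fl a P g)" for g
    by (cases g)
      (auto intro!: kk_linearI simp: fun_eq_iff summand_def kk_linear_add[OF linear_tensor_map[OF x]]
        kk_linear_smul[OF linear_tensor_map[OF x]] kk_linear_add[OF linear_tensor_map[OF c]]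
        kk_linear_smul[OF linear_tensor_map[OF c]] smul_add_right mult.commute)
  moreover have "V_op s fl a P g F \<in> part (p + gen_parity g)" if F: "F \<in> part p" for g F p
  proof (cases g)
    case (Ge \<epsilon>)
    then show ?thesis using F by (auto simp: part_fun_def summand_def part_zero)
  next
    case Gx
    have "tensor_map (pseries_mult y) (\<lambda>v. v) (F \<epsilon>) \<in> part (p + 0)" for y \<epsilon>
      using F by (intro part_tensor_map x)
        (auto simp: part_fun_def part_pseries_def pseries_mult_def zero_pseries_def split: if_splits)
    then show ?thesis by (auto simp: Gx part_fun_def intro: part_smul)
  next
    case Gc
    have "tensor_map (theta fl a j) (\<lambda>v. P (parity_inv v)) (F j) \<in> part (p + 1)" for j
    proof (intro part_tensor_map c)
      show "theta fl a j v \<in> part i" if "v \<in> part i" for v i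
        using that kk_linear_zero[OF linear_theta, of fl a j]
        by (auto simp: part_pseries_def split: if_splits)
      show "P (parity_inv w) \<in> part (i + 1)" if "w \<in> part i" for w i
        using that assms(2) by (simp only: parity_inv_part kk_linear_smul[OF assms(1)])
          (auto simp only: odd_map_def intro: part_smul)
    qed (use F in \<open>auto simp: part_fun_def\<close>)
    then show ?thesis by (auto simp: Gc part_fun_def intro: part_smul simp del: bit_add_1_eq_iff)
  qed
  ultimately show ?thesis by (simp add: gen_ops_def)
qed

lemma V_op_Gc_Gc:
  assumes "kk_linear P" "odd_map P" "P \<circ> P = id"
  shows "V_op s fl a P Gc (V_op s fl a P Gc F) = F"
proof (rule ext)
  fix \<epsilon> :: bit
  note c = linear_theta linear_P_parity_inv[OF assms(1)]
  have e: "\<epsilon> + 1 + 1 = \<epsilon>" by (cases \<epsilon>) auto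
  have P: "P (parity_inv (P (parity_inv v))) = - v" for v
    using fun_cong[OF assms(3), of v]
    by (simp add: parity_inv_odd[OF assms(1,2)] kk_linear_minus[OF assms(1)] parity_inv_inv)
  have cc: "kk_linear (\<lambda>f :: pseries. f)" "kk_linear (\<lambda>v :: 'a svec. - v)"
    by (auto intro!: kk_linearI)
  have neg: "f \<otimes>\<^sub>k (- v) = - (f \<otimes>\<^sub>k v)" for f :: pseries and v :: "'a svec"
    using pure_tensor_smul_right[of f "-1" v] by simp
  have "tensor_map (\<lambda>f. f) (\<lambda>v. - v) t = - t" for t :: "(pseries, 'a svec) tensor"
    by (induction t rule: tensor_induct)
      (simp_all add: tensor_map_pure[OF cc] kk_linear_add[OF linear_tensor_map[OF cc]] neg)
  then show "V_op s fl a P Gc (V_op s fl a P Gc F) \<epsilon> = F \<epsilon>"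
    by (simp only: V_op.simps kk_linear_smul[OF linear_tensor_map[OF c]] tensor_map_comp[OF c c]
        theta_theta P e smul_smul sqrt_m1) simp
qed

lemma V_op_Gx_Gc:
  assumes "kk_linear P"
    and x: "\<And>\<epsilon> f. s \<epsilon> \<bullet>\<^sub>k theta fl a \<epsilon> (pseries_mult (x_series fl a \<epsilon>) f) =
      k \<bullet>\<^sub>k s (\<epsilon> + 1) \<bullet>\<^sub>k pseries_mult (x_series fl a (\<epsilon> + 1)) (theta fl a \<epsilon> f)"
  shows "V_op s fl a P Gc (V_op s fl a P Gx F) = k \<bullet>\<^sub>k V_op s fl a P Gx (V_op s fl a P Gc F)"
proof (rule ext)
  fix \<epsilon> :: bit
  note l = linear_pseries_mult linear_id_kk
  note c = linear_theta linear_P_parity_inv[OF assms(1)]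
  note lin = kk_linear_smul[OF linear_tensor_map[OF l]] kk_linear_smul[OF linear_tensor_map[OF c]]
    kk_linear_add[OF linear_tensor_map[OF l]] kk_linear_add[OF linear_tensor_map[OF c]]
  have e: "\<epsilon> + 1 + 1 = \<epsilon>" by (cases \<epsilon>) auto
  have t: "s (\<epsilon> + 1) \<bullet>\<^sub>k tensor_map (theta fl a (\<epsilon> + 1)) (\<lambda>v. P (parity_inv v))
      (tensor_map (pseries_mult (x_series fl a (\<epsilon> + 1))) (\<lambda>v. v) t) =
    k \<bullet>\<^sub>k s \<epsilon> \<bullet>\<^sub>k tensor_map (pseries_mult (x_series fl a \<epsilon>)) (\<lambda>v. v)
      (tensor_map (theta fl a (\<epsilon> + 1)) (\<lambda>v. P (parity_inv v)) t)" for t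
    by (induction t rule: tensor_induct)
      (simp_all only: tensor_map_pure[OF l] tensor_map_pure[OF c] lin smul_add_right
        pure_tensor_smul_left[symmetric] x e)
  show "V_op s fl a P Gc (V_op s fl a P Gx F) \<epsilon> =
      (k \<bullet>\<^sub>k V_op s fl a P Gx (V_op s fl a P Gc F)) \<epsilon>"
    by (simp only: V_op.simps smul_fun_apply lin t) (simp add: mult_ac)
qed

lemma sgn2_add_1: "sgn2 (\<epsilon> + 1) = - sgn2 \<epsilon>"
  by (cases \<epsilon>) (simp_all add: sgn2_def)

lemma twist_signed_commute:
  assumes "kk_linear P"
  shows "V_op sgn2 Twist a P Gc (V_op sgn2 Twist a P Gx F) =
    V_op sgn2 Twist a P Gx (V_op sgn2 Twist a P Gc F)"
  using V_op_Gx_Gc[OF assms, of sgn2 Twist a 1 F] unfolding theta_x_twist sgn2_add_1 by simp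

lemma V_relations:
  assumes "kk_linear P" "odd_map P" "P \<circ> P = id" "f \<in> rc_relations"
  shows "free_ract (V_op (x_sign fl) fl a P) F f = 0"
proof (rule free_ract_relationsI[OF _ _ _ _ _ _ _ assms(4)])
  let ?V = "V_op (x_sign fl) fl a P"
  fix \<epsilon> F
  note z = kk_linear_zero[OF linear_tensor_map[OF linear_pseries_mult linear_id_kk]]
    kk_linear_zero[OF linear_tensor_map[OF linear_theta linear_P_parity_inv[OF assms(1)]]]
  show "?V (Ge \<epsilon>) (?V (Ge \<epsilon>) F) = ?V (Ge \<epsilon>) F" by (simp add: summand_def)
  show "?V (Ge (\<epsilon> + 1)) (?V (Ge \<epsilon>) F) = 0" by (cases \<epsilon>) (simp_all add: summand_def fun_eq_iff)
  show "?V (Ge 0) F + ?V (Ge 1) F = F"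
    by (rule ext, rename_tac j, case_tac j) (simp_all add: summand_def)
  show "?V (Ge \<epsilon>) (?V Gx F) = ?V Gx (?V (Ge \<epsilon>) F)" by (auto simp: summand_def fun_eq_iff z)
  show "?V (Ge \<epsilon>) (?V Gc F) = ?V Gc (?V (Ge (\<epsilon> + 1)) F)"
    by (rule ext, rename_tac j, case_tac j; cases \<epsilon>) (simp_all add: summand_def z)
  show "?V Gc (?V Gc F) = F" by (rule V_op_Gc_Gc[OF assms(1,2,3)])
  have "?V Gc (?V Gx F) = (-1) \<bullet>\<^sub>k ?V Gx (?V Gc F)"
  proof (rule V_op_Gx_Gc[OF assms(1)])
    fix \<epsilon> f
    show "x_sign fl \<epsilon> \<bullet>\<^sub>k theta fl a \<epsilon> (pseries_mult (x_series fl a \<epsilon>) f) =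
      (-1) \<bullet>\<^sub>k x_sign fl (\<epsilon> + 1) \<bullet>\<^sub>k pseries_mult (x_series fl a (\<epsilon> + 1)) (theta fl a \<epsilon> f)"
    proof (cases fl)
      case Prime
      then show ?thesis by (cases \<epsilon>) (simp_all add: sgn2_def)
    next
      case Twist
      show ?thesis unfolding Twist theta_x_twist by simp
    qed
  qed
  then show "?V Gx (?V Gc F) = - ?V Gc (?V Gx F)" by simp
qed

lemma right_rc_supermodule_V:
  assumes "kk_linear P" "odd_map P" "P \<circ> P = id"
  shows "right_rc_supermodule (V_act fl a P)"
  unfolding V_act_def
  by (rule right_rc_supermoduleI[OF gen_ops_V_op[OF assms(1,2)] V_relations[OF assms]])

lemma V_act_gen:
  assumes "kk_linear P" "odd_map P" "P \<circ> P = id"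
  shows "V_act fl a P F (rc_gen g) = V_op (x_sign fl) fl a P g F"
  by (simp add: V_act_def rc_gen_def free_act_gen
      rc_ract_abs[OF gen_ops_V_op[OF assms(1,2)] V_relations[OF assms]])

text \<open>If the sign \<open>(-1)\<^sup>\<epsilon>\<close> is nevertheless kept for the twisted flavour, then the operators
  act only through the free algebra on the generators.  Tensoring over it with the pullback of
  \<open>L(a)\<close> divides by the same subspace, as \<open>Gx\<close> annihilates \<open>L(a)\<close>.\<close>

definition V_twist_signed_act :: "int \<Rightarrow> ('m::finite svec \<Rightarrow> 'm svec) \<Rightarrow> 'm VO \<Rightarrow> free_alg \<Rightarrow> 'm VO" where
  "V_twist_signed_act a P = free_ract (V_op sgn2 Twist a P)"

definition L_free_act :: "free_alg \<Rightarrow> lmod \<Rightarrow> lmod" where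
  "L_free_act = free_lact L_op"

end

(* Since u_1 = c u_0, the space V \<otimes> L(a) is spanned by the tensors F \<otimes> u_0.
   As e(a,0) fixes u_0 and x annihilates it, F may be replaced by the constant term of its component
   at e(a,0); here it matters that x_\<epsilon> is a unit times the local coordinate.  Conversely,
   F \<otimes> u_0 \<mapsto> (constant term of F at e(a,0)) and F \<otimes> u_1 \<mapsto> (constant term of F.c at e(a,0)) is
   balanced, because c^2 = 1 and the substitution theta preserves constant terms. *)

theory Submission
  imports Defs
begin

section \<open>Quotients by kernels\<close>

text \<open>The first isomorphism theorem for superspaces. Surjectivity of \<open>\<phi>\<close> is
  contained in \<open>part\<close>, because every vector is the sum of its even and odd
  components.\<close>

lemma super_isomorphic_quotient:
  fixes \<phi> :: "'v::superspace \<Rightarrow> 'w::superspace"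
  assumes \<phi>: "kk_linear \<phi>"
    and ker: "\<And>v. v \<in> N \<longleftrightarrow> \<phi> v = 0"
    and part: "\<And>p. \<phi> ` part p = part p"
  shows "quotient_space N \<simeq>\<^sub>s (whole_space :: 'w super_struct)"
proof -
  note add = kk_linear_add[OF \<phi>] and smul = kk_linear_smul[OF \<phi>] and diff = kk_linear_diff[OF \<phi>]
  \<comment> \<open>By \<open>ker\<close>, the cosets of \<open>N\<close> are exactly the fibres of
    \<open>\<phi>\<close>.\<close>
  have coset: "v +o N = {x. \<phi> x = \<phi> v}" for v
  proof -
    have "x \<in> v +o N \<longleftrightarrow> x - v \<in> N" for x
      by (auto simp: elt_set_plus_def intro: bexI[of _ "x - v"])
    then show ?thesis by (auto simp: ker diff)
  qed
  have surj: "\<exists>v. \<phi> v = w" for w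
  proof -
    have "even_comp w \<in> \<phi> ` part 0" "odd_comp w \<in> \<phi> ` part 1"
      by (simp_all add: part even_comp_in odd_comp_in)
    then show ?thesis by (metis add even_odd_comp imageE)
  qed
  \<comment> \<open>The chosen representative is immaterial, since \<open>\<phi>\<close> is constant
    on each coset.\<close>
  define \<psi> where "\<psi> A = \<phi> (SOME x. x \<in> A)" for A
  have \<psi>: "\<psi> (v +o N) = \<phi> v" for v
    unfolding \<psi>_def coset using someI[of "\<lambda>x. x \<in> {x. \<phi> x = \<phi> v}" v] by simp
  have coset_add: "(v +o N) + (w +o N) = (v + w) +o N" for v w
  proof -
    have "\<exists>x' y'. x = x' + y' \<and> \<phi> x' = \<phi> v \<and> \<phi> y' = \<phi> w" if "\<phi> x = \<phi> v + \<phi> w" for x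
      by (rule exI[of _ v], rule exI[of _ "x - v"]) (simp add: that diff)
    then show ?thesis unfolding coset by (auto simp: set_plus_def add) metis
  qed
  have coset_smul: "smul c ` (v +o N) + N = (c \<bullet>\<^sub>k v) +o N" for c v
  proof -
    have "\<exists>x'\<in>smul c ` {x. \<phi> x = \<phi> v}. \<exists>y'\<in>N. x = x' + y'" if "\<phi> x = c \<bullet>\<^sub>k \<phi> v" for x
      by (rule bexI[of _ "c \<bullet>\<^sub>k v"], rule bexI[of _ "x - c \<bullet>\<^sub>k v"])
        (auto simp: that diff smul ker)
    then show ?thesis unfolding coset by (auto simp: set_plus_def add smul ker)
  qed
  have "bij_betw \<psi> {v +o N | v. True} UNIV"
    unfolding bij_betw_def
  proof
    show "inj_on \<psi> {v +o N | v. True}" by (auto simp: inj_on_def \<psi>) (auto simp: coset)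
    show "\<psi> ` {v +o N | v. True} = UNIV" using surj by (auto simp: image_iff) (metis \<psi>)
  qed
  moreover have "\<psi> ` {v +o N | v. v \<in> part p} = part p" for p
    unfolding part[of p, symmetric] by (auto simp: \<psi> image_iff) (metis \<psi>)
  ultimately have "super_iso (quotient_space N) whole_space \<psi>"
    by (auto simp: super_iso_def quotient_space_def whole_space_def coset_add coset_smul \<psi> add smul)
  then show ?thesis unfolding super_isomorphic_def by blast
qed

section \<open>Maps out of tensor products: parity and balancedness\<close>

lemma part_tensor_lift:
  assumes "bilin b" "\<And>i j v w. v \<in> part i \<Longrightarrow> w \<in> part j \<Longrightarrow> b v w \<in> part (i + j)" "t \<in> part p"
  shows "tensor_lift b t \<in> part p"
  using assms(3) unfolding part_tensor_def[of p]
proof (induction rule: kk.span_induct_alt)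
  case base
  show ?case by (simp only: kk_linear_zero[OF linear_tensor_lift[OF assms(1)]] part_zero)
next
  case (step c x y)
  then obtain v w i j where x: "x = v \<otimes>\<^sub>k w" "v \<in> part i" "w \<in> part j" "i + j = p" by auto
  have "tensor_lift b x \<in> part p"
    unfolding x(1) tensor_lift_pure[OF assms(1)] using assms(2)[OF x(2,3)] by (simp only: x(4))
  then show ?case
    using step(2) unfolding kk_linear_add[OF linear_tensor_lift[OF assms(1)]]
      kk_linear_smul[OF linear_tensor_lift[OF assms(1)]]
    by (intro part_add part_smul)
qed

lemma pure_tensor_part: "v \<in> part i \<Longrightarrow> w \<in> part j \<Longrightarrow> v \<otimes>\<^sub>k w \<in> part (i + j)"
  unfolding part_tensor_def by (intro kk.span_base) auto

text \<open>A word acts from the right by its first letter first and from the left by its last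
  letter first. So its letters can be carried across \<open>b\<close> one at a time, and
  balancedness on generators suffices.\<close>

lemma balanced_free_act:
  assumes b: "bilin b" and gen: "\<And>g v l. b (ops g v) l = b v (lops g l)"
  shows "b (free_ract ops v f) l = b v (free_lact lops f l)"
proof (induction f rule: poly_mapping_free_induct)
  have l: "kk_linear (\<lambda>v. b v l)" and r: "kk_linear (b v)" for v l
    using b by (auto simp: bilin_def)
  {
    case zero
    show ?case by (simp add: free_act_simps kk_linear_zero[OF l] kk_linear_zero[OF r])
  next
    case (single w c)
    have "b (fold ops gs v) l = b v (foldr lops gs l)" for gs
      by (induction gs arbitrary: v) (simp_all add: gen)
    then show ?case by (simp add: free_act_simps kk_linear_smul[OF l] kk_linear_smul[OF r])
  next
    case (add f g)
    then show ?case by (simp add: free_act_simps kk_linear_add[OF l] kk_linear_add[OF r])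
  }
qed

text \<open>When the relations act by zero, the class of \<open>f\<close> acts exactly as
  \<open>f\<close> does, so both tensor products divide by the same span. Everything can then be
  computed over the free algebra.\<close>

lemma tensor_over_rc_act:
  assumes "gen_ops ops" "\<And>v f. f \<in> rc_relations \<Longrightarrow> free_ract ops v f = 0"
    and "gen_ops lops" "\<And>v f. f \<in> rc_relations \<Longrightarrow> free_lact lops f v = 0"
  shows "tensor_over (rc_ract ops) (rc_lact lops) = tensor_over (free_ract ops) (free_lact lops)"
proof -
  have "{rc_ract ops v r \<otimes>\<^sub>k l - v \<otimes>\<^sub>k rc_lact lops r l | v r l. True} =
      {free_ract ops v f \<otimes>\<^sub>k l - v \<otimes>\<^sub>k free_lact lops f l | v f l. True}" (is "?A = ?B")
  proof
    show "?A \<subseteq> ?B" by (auto simp: rc_ract_def rc_lact_def)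
    have "free_ract ops v f \<otimes>\<^sub>k l - v \<otimes>\<^sub>k free_lact lops f l =
        rc_ract ops v (abs_rc f) \<otimes>\<^sub>k l - v \<otimes>\<^sub>k rc_lact lops (abs_rc f) l" for v f l
      by (simp only: rc_ract_abs[OF assms(1,2)] rc_lact_abs[OF assms(3,4)])
    then show "?B \<subseteq> ?A" by blast
  qed
  then show ?thesis by (simp only: tensor_over_def)
qed

section \<open>Constant terms and the local coordinate\<close>

text \<open>Expansions are stored in the local coordinate, so the coefficient of index 0 is the
  value at the centre: this is evaluation at the centre, tensored with the identity.\<close>

definition const_term :: "(pseries, 'm::finite svec) tensor \<Rightarrow> 'm svec" where
  "const_term = tensor_lift (\<lambda>f v. fps_nth (expansion f) 0 \<bullet>\<^sub>k v)"

lemma bilin_const_term: "bilin (\<lambda>f (v :: 'm::finite svec). fps_nth (expansion f) 0 \<bullet>\<^sub>k v)"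
  by (auto simp: bilin_def smul_add_left smul_add_right smul_smul mult.commute intro!: kk_linearI)

lemma const_term_pure: "const_term (f \<otimes>\<^sub>k v) = fps_nth (expansion f) 0 \<bullet>\<^sub>k v"
  unfolding const_term_def by (rule tensor_lift_pure[OF bilin_const_term])

lemma linear_const_term: "kk_linear const_term"
  unfolding const_term_def by (rule linear_tensor_lift[OF bilin_const_term])

lemma part_const_term: "t \<in> part p \<Longrightarrow> const_term t \<in> part p"
  unfolding const_term_def
proof (rule part_tensor_lift[OF bilin_const_term])
  fix i j and f :: pseries and v :: "'a svec"
  assume "f \<in> part i" "v \<in> part j"
  then show "fps_nth (expansion f) 0 \<bullet>\<^sub>k v \<in> part (i + j)"
    by (cases i) (auto simp: part_pseries_def part_zero intro: part_smul)
qed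

text \<open>The scalar \<open>k\<close> covers both operators of interest: \<open>k = 0\<close> for
  multiplication by \<open>x_series\<close>, and \<open>k = 1\<close> for
  \<open>theta\<close>.\<close>

lemma const_term_tensor_map:
  assumes "kk_linear h" "kk_linear g" "\<And>f. fps_nth (expansion (h f)) 0 = k * fps_nth (expansion f) 0"
  shows "const_term (tensor_map h g t) = k \<bullet>\<^sub>k g (const_term t)"
  by (induction t rule: tensor_induct)
    (simp_all add: tensor_map_pure[OF assms(1,2)] const_term_pure assms(3) kk_linear_smul[OF assms(2)]
      smul_smul kk_linear_add[OF linear_const_term] kk_linear_add[OF assms(2)] smul_add_right
      kk_linear_add[OF linear_tensor_map[OF assms(1,2)]])

text \<open>The numerator is the local coordinate, and the denominator takes a nonzero value at the
  centre \<open>c\<close>, namely \<open>c\<close> or \<open>2 * c\<close>, hence is a unit.\<close>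

lemma x_series_factor: "\<exists>u :: kk fps. u $ 0 \<noteq> 0 \<and> x_series fl a \<epsilon> = fps_X * u"
proof (cases fl)
  case Prime
  have "x_series Prime a \<epsilon> = fps_X * inverse (fps_const (centre Prime a \<epsilon>))"
    by (simp add: Let_def z_at_def fps_divide_unit fps_const_inverse del: centre.simps)
  then show ?thesis using Prime by (intro exI[of _ "inverse (fps_const (centre Prime a \<epsilon>))"]) simp
next
  case Twist
  define c where "c = centre Twist a \<epsilon>"
  have "c \<noteq> 0" by (simp add: c_def)
  then have u: "(z_at c + fps_const c) $ 0 \<noteq> 0" by (simp add: z_at_def)
  then have "x_series Twist a \<epsilon> = fps_X * inverse (z_at c + fps_const c)"
    by (simp add: Let_def z_at_def fps_divide_unit del: centre.simps flip: c_def)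
  then show ?thesis using Twist u by (intro exI[of _ "inverse (z_at c + fps_const c)"]) simp
qed

lemma const_term_x:
  "const_term (tensor_map (pseries_mult (x_series fl a \<epsilon>)) (\<lambda>v. v) t) = 0"
proof -
  have "fps_nth (expansion (pseries_mult (x_series fl a \<epsilon>) f)) 0 = 0 * fps_nth (expansion f) 0" for f
    using x_series_factor[of fl a \<epsilon>] by (auto simp: pseries_mult_def simp del: x_series.simps)
  from const_term_tensor_map[OF linear_pseries_mult linear_id_kk this] show ?thesis by simp
qed

text \<open>Division with remainder by \<open>x_series\<close>, which generates the maximal ideal of
  the power series ring. It allows series to be replaced by constants modulo the image of
  \<open>Gx\<close>.\<close>

lemma pseries_split: "\<exists>g. f = fps_nth (expansion f) 0 \<bullet>\<^sub>k PSeries 1 + pseries_mult (x_series fl a \<epsilon>) g"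
proof -
  obtain u :: "kk fps" where u: "u $ 0 \<noteq> 0" "x_series fl a \<epsilon> = fps_X * u" using x_series_factor by blast
  let ?F = "expansion f"
  \<comment> \<open>\<open>fps_shift 1\<close> divides the series minus its constant term by
    \<open>fps_X\<close>, and \<open>inverse u\<close> cancels the unit in
    \<open>x_series\<close>.\<close>
  define g where "g = inverse u * fps_shift 1 ?F"
  have "x_series fl a \<epsilon> * g = fps_X * (inverse u * u) * fps_shift 1 ?F"
    by (simp only: u(2) g_def mult_ac)
  also have "\<dots> = fps_X * fps_shift 1 ?F" by (simp add: inverse_mult_eq_1[OF u(1)])
  also have "\<dots> = ?F - fps_const (?F $ 0)"
    by (rule fps_ext) (simp add: fps_X_mult_nth)
  finally have "?F = fps_const (?F $ 0) + x_series fl a \<epsilon> * g" by simp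
  then have "f = (?F $ 0) \<bullet>\<^sub>k PSeries 1 + pseries_mult (x_series fl a \<epsilon>) (PSeries g)"
    by (intro pseries.expand) (simp add: pseries_mult_def del: x_series.simps)
  then show ?thesis by blast
qed

section \<open>The balanced evaluation map\<close>

text \<open>\<open>C\<close> stands for the right action of \<open>Gc\<close>, which moves the
  Clifford generator in \<open>u_1 = c u_0\<close> over to \<open>F\<close>.\<close>

definition eval_bilin :: "('m::finite VO \<Rightarrow> 'm VO) \<Rightarrow> 'm VO \<Rightarrow> lmod \<Rightarrow> 'm svec" where
  "eval_bilin C F l = ucoeff l 0 \<bullet>\<^sub>k const_term (F 0) + ucoeff l 1 \<bullet>\<^sub>k const_term (C F 0)"

lemma bilin_eval_bilin:
  assumes "kk_linear C"
  shows "bilin (eval_bilin C)"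
  unfolding bilin_def
  by (auto intro!: kk_linearI simp: eval_bilin_def kk_linear_add[OF assms] kk_linear_smul[OF assms]
      kk_linear_add[OF linear_const_term] kk_linear_smul[OF linear_const_term]
      smul_add_left smul_add_right smul_smul mult.commute)

text \<open>For \<open>Ge\<close>, \<open>Gc\<close> exchanges the two summands just as it exchanges
  \<open>u_0\<close> and \<open>u_1\<close>. For \<open>Gx\<close> both sides vanish, whatever the
  signs \<open>s\<close> are. For \<open>Gc\<close> the two terms of \<open>eval_bilin\<close> trade
  places, because \<open>Gc\<close> squares to the identity.\<close>

lemma eval_bilin_gen:
  fixes P :: "'m::finite svec \<Rightarrow> 'm svec"
  assumes "kk_linear P" "odd_map P" "P \<circ> P = id"
  shows "eval_bilin (V_op s fl a P Gc) (V_op s fl a P g F) l =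
    eval_bilin (V_op s fl a P Gc) F (L_op g l)"
proof -
  note c = linear_theta linear_P_parity_inv[OF assms(1)]
  note z = kk_linear_zero[OF linear_tensor_map[OF c]] kk_linear_zero[OF linear_const_term]
  \<comment> \<open>\<open>fps_compose\<close> keeps the coefficient of index 0; the factor 1
    matches the form required by \<open>const_term_tensor_map\<close>.\<close>
  have theta0: "fps_nth (expansion (theta fl a \<epsilon> f)) 0 = 1 * fps_nth (expansion f) 0" for \<epsilon> f
    by (cases fl) simp_all
  show ?thesis
  proof (cases g)
    case (Ge \<epsilon>)
    then show ?thesis by (cases \<epsilon>) (simp_all add: eval_bilin_def summand_def z)
  next
    case Gx
    then show ?thesis
      by (simp add: eval_bilin_def const_term_tensor_map[OF c theta0]
          kk_linear_smul[OF linear_const_term] kk_linear_smul[OF linear_tensor_map[OF c]]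
          const_term_x kk_linear_zero[OF c(2)] del: x_series.simps theta.simps)
  next
    case Gc
    then show ?thesis
      by (simp add: eval_bilin_def V_op_Gc_Gc[OF assms] add.commute del: V_op.simps)
  qed
qed

section \<open>The tensor product over the free algebra\<close>

text \<open>The evaluation \<open>\<phi>\<close> kills the span of the balancing relations, and
  \<open>\<iota>\<close> is a section of it that is also a left inverse up to that span, so the span
  is the whole kernel. General signs \<open>s\<close> treat the anticommuting and the commuting
  choice at once.\<close>

lemma tensor_over_free_act:
  fixes P :: "'m::finite svec \<Rightarrow> 'm svec"
  assumes P: "kk_linear P" "odd_map P" "P \<circ> P = id" and s: "s 0 \<noteq> 0"
  shows "tensor_over (free_ract (V_op s fl a P)) (free_lact L_op) \<simeq>\<^sub>s (whole_space :: 'm svec super_struct)"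
  unfolding tensor_over_def
proof (rule super_isomorphic_quotient)
  let ?V = "V_op s fl a P"
  let ?R = "{free_ract ?V v r \<otimes>\<^sub>k l - v \<otimes>\<^sub>k free_lact L_op r l | v r l. True}"
  define b where "b = eval_bilin (?V Gc)"
  define \<phi> where "\<phi> = tensor_lift b"
  define \<iota> :: "'m svec \<Rightarrow> ('m VO, lmod) tensor" where
    "\<iota> w = summand 0 (PSeries 1 \<otimes>\<^sub>k w) \<otimes>\<^sub>k uvec 0" for w
  have lin: "kk_linear (?V g)" and C_part: "F \<in> part p \<Longrightarrow> ?V Gc F \<in> part (p + 1)" for g F p
    using gen_ops_V_op[OF P(1,2), of s fl a, unfolded gen_ops_def, rule_format, of g]
      gen_ops_V_op[OF P(1,2), of s fl a, unfolded gen_ops_def, rule_format, of Gc]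
    by (simp_all only: gen_parity.simps)
  have b: "bilin b" unfolding b_def by (rule bilin_eval_bilin[OF lin])
  show \<phi>: "kk_linear \<phi>" unfolding \<phi>_def by (rule linear_tensor_lift[OF b])
  note \<phi>_pure = tensor_lift_pure[OF b, folded \<phi>_def]
  have summand_add: "summand 0 (x + y) = summand 0 x + (summand 0 y :: 'm VO)"
    and summand_smul: "summand 0 (c \<bullet>\<^sub>k x) = c \<bullet>\<^sub>k (summand 0 x :: 'm VO)" for x y c
    by (auto simp: summand_def fun_eq_iff)
  have \<iota>: "kk_linear \<iota>"
    by (rule kk_linearI)
      (simp_all add: \<iota>_def pure_tensor_add_right pure_tensor_smul_right summand_add summand_smul
        pure_tensor_add_left pure_tensor_smul_left)
  have \<phi>\<iota>: "\<phi> (\<iota> w) = w" for w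
    by (simp add: \<iota>_def \<phi>_pure b_def eval_bilin_def uvec_def summand_def const_term_pure smul_one)

  have gen: "?V g F \<otimes>\<^sub>k l - F \<otimes>\<^sub>k L_op g l \<in> kk.span ?R" for g F l
  proof -
    have "free_ract ?V F (gen_elt g) \<otimes>\<^sub>k l - F \<otimes>\<^sub>k free_lact L_op (gen_elt g) l \<in> kk.span ?R"
      by (rule kk.span_base) blast
    then show ?thesis by (simp only: free_act_gen)
  qed
  \<comment> \<open>\<open>Gx\<close> annihilates \<open>u_0\<close>, so its balancing relation puts
    \<open>F.x \<otimes> u_0\<close> in the span; dividing by \<open>s 0\<close> removes the
    sign.\<close>
  have x: "summand 0 (pseries_mult (x_series fl a 0) g \<otimes>\<^sub>k v) \<otimes>\<^sub>k uvec 0 \<in> kk.span ?R" for g v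
  proof -
    have "?V Gx (summand 0 (g \<otimes>\<^sub>k v)) \<otimes>\<^sub>k uvec 0 =
        s 0 \<bullet>\<^sub>k (summand 0 (pseries_mult (x_series fl a 0) g \<otimes>\<^sub>k v) \<otimes>\<^sub>k uvec 0)"
      by (simp only: V_op_pure_Gx pseries_mult_def summand_smul pure_tensor_smul_left)
    moreover have "?V Gx (summand 0 (g \<otimes>\<^sub>k v)) \<otimes>\<^sub>k uvec 0 \<in> kk.span ?R"
      using gen[of Gx "summand 0 (g \<otimes>\<^sub>k v)" "uvec 0"]
        \<comment> \<open>The scalar 0 turns this instance into the vanishing of a tensor whose
          second factor is 0.\<close>
        pure_tensor_smul_right[of "summand 0 (g \<otimes>\<^sub>k v)" 0 "0 :: lmod"]
      by (simp only: L_op_uvec kk.scale_zero_left diff_zero)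
    ultimately have "s 0 \<bullet>\<^sub>k (summand 0 (pseries_mult (x_series fl a 0) g \<otimes>\<^sub>k v) \<otimes>\<^sub>k uvec 0)
        \<in> kk.span ?R"
      by (simp only:)
    from kk.span_scale[OF this, of "inverse (s 0)"] show ?thesis
      by (simp only: smul_smul left_inverse[OF s] smul_one)
  qed
  have u0_summand: "summand 0 t \<otimes>\<^sub>k uvec 0 - \<iota> (const_term t) \<in> kk.span ?R" for t
  proof (induction t rule: tensor_induct)
    case (pure f v)
    obtain g where "f = fps_nth (expansion f) 0 \<bullet>\<^sub>k PSeries 1 + pseries_mult (x_series fl a 0) g"
      using pseries_split by blast
    then have "f \<otimes>\<^sub>k v = fps_nth (expansion f) 0 \<bullet>\<^sub>k (PSeries 1 \<otimes>\<^sub>k v) +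
        pseries_mult (x_series fl a 0) g \<otimes>\<^sub>k v"
      by (metis pure_tensor_add_left pure_tensor_smul_left)
    then have "summand 0 (f \<otimes>\<^sub>k v) \<otimes>\<^sub>k uvec 0 = fps_nth (expansion f) 0 \<bullet>\<^sub>k \<iota> v +
        summand 0 (pseries_mult (x_series fl a 0) g \<otimes>\<^sub>k v) \<otimes>\<^sub>k uvec 0"
      by (simp only: \<iota>_def summand_add summand_smul pure_tensor_add_left pure_tensor_smul_left)
    moreover have "\<iota> (const_term (f \<otimes>\<^sub>k v)) = fps_nth (expansion f) 0 \<bullet>\<^sub>k \<iota> v"
      by (simp only: const_term_pure kk_linear_smul[OF \<iota>])
    ultimately show ?case using x[of g v] by simp
  next
    case (add t u)
    from kk.span_add[OF this] show ?case
      by (simp only: summand_add pure_tensor_add_left kk_linear_add[OF linear_const_term]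
          kk_linear_add[OF \<iota>] add_diff_add)
  qed
  \<comment> \<open>The relation for \<open>Ge 0\<close>, which fixes \<open>u_0\<close>, replaces
    \<open>F\<close> by its component at 0.\<close>
  have u0: "F \<otimes>\<^sub>k uvec 0 - \<iota> (const_term (F 0)) \<in> kk.span ?R" for F
    using kk.span_diff[OF u0_summand[of "F 0"] gen[of "Ge 0" F "uvec 0"]]
    by (simp add: L_op_uvec del: L_op.simps)
  \<comment> \<open>The relation for \<open>Gc\<close> replaces \<open>F \<otimes> u_1\<close> by
    \<open>F.c \<otimes> u_0\<close>, to which \<open>u0\<close> applies.\<close>
  have u1: "F \<otimes>\<^sub>k uvec 1 - \<iota> (const_term (?V Gc F 0)) \<in> kk.span ?R" for F
    using kk.span_diff[OF u0[of "?V Gc F"] gen[of Gc F "uvec 0"]]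
    by (simp add: L_op_uvec del: L_op.simps V_op.simps)
  have retract: "t - \<iota> (\<phi> t) \<in> kk.span ?R" for t
  proof (induction t rule: tensor_induct)
    case (pure F l)
    let ?l0 = "ucoeff l 0" and ?l1 = "ucoeff l 1"
    have "l = ?l0 \<bullet>\<^sub>k uvec 0 + ?l1 \<bullet>\<^sub>k uvec 1"
      by (rule lmod.expand, rule ext, rename_tac j, case_tac j) (simp_all add: uvec_def)
    then have "F \<otimes>\<^sub>k l = ?l0 \<bullet>\<^sub>k (F \<otimes>\<^sub>k uvec 0) + ?l1 \<bullet>\<^sub>k (F \<otimes>\<^sub>k uvec 1)"
      by (metis pure_tensor_add_right pure_tensor_smul_right)
    moreover have "\<iota> (\<phi> (F \<otimes>\<^sub>k l)) =
        ?l0 \<bullet>\<^sub>k \<iota> (const_term (F 0)) + ?l1 \<bullet>\<^sub>k \<iota> (const_term (?V Gc F 0))"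
      by (simp only: \<phi>_pure b_def eval_bilin_def kk_linear_add[OF \<iota>] kk_linear_smul[OF \<iota>])
    ultimately have "F \<otimes>\<^sub>k l - \<iota> (\<phi> (F \<otimes>\<^sub>k l)) = ?l0 \<bullet>\<^sub>k (F \<otimes>\<^sub>k uvec 0 - \<iota> (const_term (F 0))) +
        ?l1 \<bullet>\<^sub>k (F \<otimes>\<^sub>k uvec 1 - \<iota> (const_term (?V Gc F 0)))"
      by (simp only: kk.scale_right_diff_distrib add_diff_add)
    then show ?case using u0 u1 by (simp only: kk.span_add kk.span_scale)
  next
    case (add t u)
    from kk.span_add[OF this] show ?case
      by (simp only: kk_linear_add[OF \<phi>] kk_linear_add[OF \<iota>] add_diff_add)
  qed
  have kill: "\<phi> t = 0" if "t \<in> kk.span ?R" for t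
    using that
  proof (induction rule: kk.span_induct_alt)
    case base
    show ?case by (rule kk_linear_zero[OF \<phi>])
  next
    case (step c x y)
    then obtain F r l where "x = free_ract ?V F r \<otimes>\<^sub>k l - F \<otimes>\<^sub>k free_lact L_op r l" by blast
    moreover have "b (free_ract ?V F r) l = b F (free_lact L_op r l)"
      by (rule balanced_free_act[OF b]) (simp only: b_def eval_bilin_gen[OF P])
    ultimately have "\<phi> x = 0" by (simp add: kk_linear_diff[OF \<phi>] \<phi>_pure)
    with step show ?case by (simp add: kk_linear_add[OF \<phi>] kk_linear_smul[OF \<phi>])
  qed
  \<comment> \<open>If \<open>\<phi> t\<close> is 0, then \<open>retract\<close> places
    \<open>t\<close> itself in the span.\<close>
  show "t \<in> kk.span ?R \<longleftrightarrow> \<phi> t = 0" for t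
    using kill retract[of t] by (auto simp: kk_linear_zero[OF \<iota>])

  show "\<phi> ` part p = part p" for p
  proof
    \<comment> \<open>A homogeneous \<open>l\<close> has only one nonzero coefficient. For odd
      \<open>l\<close> the parity shift by \<open>Gc\<close> accounts for the oddness of
      \<open>u_1\<close>.\<close>
    have "b F l \<in> part (i + j)" if "F \<in> part i" "l \<in> part j" for F l i j
    proof (cases j)
      case zero
      then show ?thesis using that
        by (auto simp: b_def eval_bilin_def part_lmod_def part_fun_def simp del: V_op.simps
            intro!: part_smul part_const_term)
    next
      case one
      then show ?thesis using that(2) C_part[OF that(1)]
        by (auto simp: b_def eval_bilin_def part_lmod_def part_fun_def simp del: V_op.simps
            intro!: part_smul part_const_term)
    qed
    from part_tensor_lift[OF b this] show "\<phi> ` part p \<subseteq> part p" by (auto simp: \<phi>_def)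
    have "\<iota> w \<in> part p" if "w \<in> part p" for w
    proof -
      have "PSeries 1 \<otimes>\<^sub>k w \<in> part (0 + p)"
        using that by (intro pure_tensor_part) (simp_all add: part_pseries_def)
      then have "summand 0 (PSeries 1 \<otimes>\<^sub>k w) \<in> part p"
        by (simp only: add_0) (simp add: part_fun_def summand_def part_zero)
      moreover have "uvec 0 \<in> part 0" by (simp add: part_lmod_def uvec_def)
      ultimately have "\<iota> w \<in> part (p + 0)"
        unfolding \<iota>_def by (rule pure_tensor_part)
      then show ?thesis by (simp only: add_0_right)
    qed
    then show "part p \<subseteq> \<phi> ` part p" using \<phi>\<iota> by (metis image_eqI subsetI)
  qed
qed

section \<open>Both flavours, and the twisted one with its sign\<close>

theorem proposition1p5:
  fixes a :: int and P :: "'m::finite svec \<Rightarrow> 'm svec"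
  assumes "CARD('m) \<ge> 2"
    and "Vector_Spaces.linear smul smul P"
    and "odd_map P"
    and "P \<circ> P = id"
  shows "tensor_over (V_act Prime a P) L_act \<simeq>\<^sub>s (whole_space :: 'm svec super_struct)
    \<and> tensor_over (V_act Twist a P) L_act \<simeq>\<^sub>s (whole_space :: 'm svec super_struct)
    \<and> tensor_over (V_twist_signed_act a P) L_free_act \<simeq>\<^sub>s (whole_space :: 'm svec super_struct)"
proof -
  note P = assms(2-4)
  have "tensor_over (V_act fl a P) L_act \<simeq>\<^sub>s (whole_space :: 'm svec super_struct)" for fl
  proof -
    have "tensor_over (V_act fl a P) L_act =
        tensor_over (free_ract (V_op (x_sign fl) fl a P)) (free_lact L_op)"
      unfolding V_act_def L_act_def
      by (rule tensor_over_rc_act[OF gen_ops_V_op[OF P(1,2)] V_relations[OF P] gen_ops_L_op L_relations])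
    moreover have "x_sign fl 0 \<noteq> 0" by (cases fl) (simp_all add: sgn2_def)
    ultimately show ?thesis by (metis tensor_over_free_act[OF P])
  qed
  moreover have "tensor_over (V_twist_signed_act a P) L_free_act \<simeq>\<^sub>s (whole_space :: 'm svec super_struct)"
    unfolding V_twist_signed_act_def L_free_act_def
    by (rule tensor_over_free_act[OF P]) (simp add: sgn2_def)
  ultimately show ?thesis by blast
qed

end
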